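(* Let $p\ge1$, let $n_0\ge0$, $n_1,\dots,n_p\ge1$ and $k\ge1$ be integers with $n_p>n_j$ for $j=1,\dots,p-1$, and put $n=n_0+n_1+\dots+n_p$. Then $$\frac{D_p(n_1,\dots,n_{p-1},n_p+1;n_0;0,0,k;q)}{D_p(n_1,\dots,n_{p-1},n_p;n_0;0,0,k;q)}=\frac{[n_p+1]_{q^{k+1}}}{[k]_q!}\,\frac{\Gamma_q\big((k+1)(n_p+1)+k\sum_{j=0}^{p-1}n_j\big)}{\Gamma_q\big(1+(k+1)n_p+k\sum_{j=0}^{p-1}n_j\big)}=\frac{[n_p+1]_{q^{k+1}}}{[k]_q!}\,\frac{[k(n+1)+n_p]_q!}{[kn+n_p]_q!}.$$
   Context: For integers $m_0\ge0$, $m_1,\dots,m_p\ge1$ and $M=m_0+m_1+\dots+m_p$, let $\widetilde J_\alpha=\{m_0+\dots+m_{\alpha-1}+1,\dots,m_0+\dots+m_\alpha\}$ for $1\le\alpha\le p$ and define $$D_p(m_1,\dots,m_p;m_0;0,0,k;q):=\mathrm{CT}\bigg(\prod_{\alpha=1}^p\ \prod_{\substack{i<j\\ i,j\in\widetilde J_\alpha}}(z_i-q^{k+1}z_j)(z_i^{-1}-q^kz_j^{-1})\prod_{1\le i<j\le M}\Big(\frac{z_i}{z_j};q\Big)_k\Big(q\frac{z_j}{z_i};q\Big)_k\bigg),$$ where $\mathrm{CT}$ is the constant term with respect to $z_1,\dots,z_M$, $q$ is an indeterminate and $(a;q)_k:=\prod_{m=0}^{k-1}(1-aq^m)$. Further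 $[m]_x:=(1-x^m)/(1-x)$, $[m]_x!:=[1]_x\cdots[m]_x$, and $\Gamma_q$ is the $q$-gamma function, needed only at positive integers, where $\Gamma_q(1+m)=[m]_q!$. *)

theory Defs
  imports "HOL-Library.Poly_Mapping" "HOL-Computational_Algebra.Computational_Algebra"
begin

text \<open>
  Laurent polynomials in the variables \<open>z 0, z 1, z 2, \<dots>\<close> are represented as the group algebra of the
  finitely supported integer exponent vectors; multiplication is the convolution product of
  \<open>HOL-Library.Poly_Mapping\<close>.
\<close>

type_synonym 'a laurent = "(nat \<Rightarrow>\<^sub>0 int) \<Rightarrow>\<^sub>0 'a"

definition lconst :: "'a::comm_ring_1 \<Rightarrow> 'a laurent"
  where "lconst c = Poly_Mapping.single 0 c"

definition lvar :: "nat \<Rightarrow> 'a::comm_ring_1 laurent"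
  where "lvar i = Poly_Mapping.single (Poly_Mapping.single i 1) 1"

definition lvar_inv :: "nat \<Rightarrow> 'a::comm_ring_1 laurent"
  where "lvar_inv i = Poly_Mapping.single (Poly_Mapping.single i (-1)) 1"

definition constant_term :: "'a::comm_ring_1 laurent \<Rightarrow> 'a"
  where "constant_term f = Poly_Mapping.lookup f 0"

lemma lvar_mult_lvar_inv: "lvar i * lvar_inv i = (1 :: 'a::comm_ring_1 laurent)"
  by (simp add: lvar_def lvar_inv_def Poly_Mapping.mult_single flip: Poly_Mapping.single_add
        Poly_Mapping.single_one)

definition qpochhammer :: "'a::comm_ring_1 \<Rightarrow> 'a \<Rightarrow> nat \<Rightarrow> 'a"
  where "qpochhammer a q k = (\<Prod>m<k. 1 - a * q ^ m)"

definition qnumber :: "'a::field \<Rightarrow> nat \<Rightarrow> 'a"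
  where "qnumber x m = (1 - x ^ m) / (1 - x)"

definition qfactorial :: "'a::field \<Rightarrow> nat \<Rightarrow> 'a"
  where "qfactorial x m = (\<Prod>i=1..m. qnumber x i)"

text \<open>The \<open>q\<close>-gamma function at positive integers; the value at the pole \<open>0\<close> is a dummy.\<close>

primrec qGamma :: "'a::field \<Rightarrow> nat \<Rightarrow> 'a" where
  "qGamma q 0 = 0"
| "qGamma q (Suc m) = qfactorial q m"

text \<open>A tuple \<open>(m\<^sub>1, \<dots>, m\<^sub>p; m\<^sub>0)\<close> is a function \<open>m\<close> of which only the values on \<open>{0..p}\<close> matter.\<close>

definition Jblock :: "(nat \<Rightarrow> nat) \<Rightarrow> nat \<Rightarrow> nat set"
  where "Jblock m \<alpha> = {(\<Sum>j<\<alpha>. m j) + 1 .. (\<Sum>j\<le>\<alpha>. m j)}"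

definition D_integrand :: "nat \<Rightarrow> (nat \<Rightarrow> nat) \<Rightarrow> nat \<Rightarrow> 'a::comm_ring_1 \<Rightarrow> 'a laurent"
  where "D_integrand p m k q =
    (\<Prod>\<alpha>=1..p. \<Prod>(i, j) \<in> {(i, j). i \<in> Jblock m \<alpha> \<and> j \<in> Jblock m \<alpha> \<and> i < j}.
        (lvar i - lconst (q ^ (k + 1)) * lvar j) * (lvar_inv i - lconst (q ^ k) * lvar_inv j)) *
    (\<Prod>(i, j) \<in> {(i, j). 1 \<le> i \<and> i < j \<and> j \<le> (\<Sum>l\<le>p. m l)}.
        qpochhammer (lvar i * lvar_inv j) (lconst q) k *
        qpochhammer (lconst q * (lvar j * lvar_inv i)) (lconst q) k)"

text \<open>\<open>D p m k q\<close> stands for \<open>D\<^sub>p(m\<^sub>1, \<dots>, m\<^sub>p; m\<^sub>0; 0, 0, k; q)\<close>.\<close>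

definition D :: "nat \<Rightarrow> (nat \<Rightarrow> nat) \<Rightarrow> nat \<Rightarrow> 'a::comm_ring_1 \<Rightarrow> 'a"
  where "D p m k q = constant_term (D_integrand p m k q)"

text \<open>The indeterminate, as an element of the field of rational functions over the rationals.\<close>

definition q_indet :: "rat poly fract"
  where "q_indet = Fraction_Field.Fract [:0, 1:] 1"

end

(*
  Write D(n) for the denominator. The defining integrand is the product over i < j of
  (z_i/z_j; q)_l (q z_j/z_i; q)_l with l = k + 1 inside a block 1, ..., p and l = k otherwise.

  (1) Antisymmetrizing over the enlarged last block splits off a variable w:
  D(n_p + 1) = [n_p + 1]_{q^(k+1)} F(q^k), where F(q^a) is the constant term of the integrand of
  D(n) times the product over j of (z_j/w; q)_{b_j} (q w/z_j; q)_a, with b_j = k + 1 in the last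
  block and b_j = k elsewhere.

  (2) F is a polynomial in u = q^a of degree at most L = sum_j b_j = k n + n_p, and F(1) = D(n).

  (3) F(q^-h) = 0 for 1 <= h <= L. The functional extracting the coefficient of z_j^-e agrees for
  e > -h with a combination of evaluations at q^-i, b_j <= i < h. Expand the product over j of
  (evaluations + remainder). If all variables are evaluated, the pair factors force the largest i
  to be at least L, so the term vanishes; if the variables outside R remain, the same estimate
  shows that the total degree in them exceeds -h times their number, while every remainder only
  sees exponents <= -h.

  Hence F(q^k) / D(n) is the product over h = 1, ..., L of (1 - q^(k+h)) / (1 - q^h).

  (4) D(n) is not 0, since at q = 1 it is the sum of the squares of the coefficients of a
  nonzero Laurent polynomial.
*)
theory Submission
  imports Defs "HOL-Combinatorics.Transposition" "HOL-Library.FuncSet"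
begin

text \<open>At a = -h the factor (q w / z_j; q)_a becomes 1 / ((1 - x) (1 - x / q) ... (1 - x / q^(h
  - 1))) with x = w / z_j; its h poles are where the evaluation points come from, and (z_j / w;
  q)_(b_j) cancels the first b_j of them. Partial fractions describe the coefficients only for
  exponents above -h, so the remainders cannot be dropped, and the mixed terms, with some variables
  evaluated and others not, have to be killed as well. The degree estimate for these is tight: for a
  variable in one of the blocks 1, ..., p - 1 it only gives "at most h". One strict inequality must
  be found among the remaining variables, and comparing such a block with the last, largest one
  provides it. This is the role of n_p > n_j. Since a = -h has no integrand of its own, everything
  is phrased through linear functionals on exponent vectors: the Laurent polynomial stays fixed and
  only the weights depend on a.\<close>

section \<open>Laurent polynomials\<close>

text \<open>Ring homomorphisms and linear functionals on Laurent polynomials are both instances of \<open>lext\<close>.\<close>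

definition lext :: "('a::comm_ring_1 \<Rightarrow> 'r::comm_ring_1) \<Rightarrow> ((nat \<Rightarrow>\<^sub>0 int) \<Rightarrow> 'r) \<Rightarrow> 'a laurent \<Rightarrow> 'r"
  where "lext h \<chi> f = (\<Sum>e\<in>Poly_Mapping.keys f. h (Poly_Mapping.lookup f e) * \<chi> e)"

lemma lext_superset:
  assumes "h 0 = 0" "finite A" "Poly_Mapping.keys f \<subseteq> A"
  shows "lext h \<chi> f = (\<Sum>e\<in>A. h (Poly_Mapping.lookup f e) * \<chi> e)"
  unfolding lext_def using assms
  by (intro sum.mono_neutral_left) (auto simp: in_keys_iff)

lemma lext_zero [simp]: "lext h \<chi> 0 = 0"
  by (simp add: lext_def)

lemma lext_single: "h 0 = 0 \<Longrightarrow> lext h \<chi> (Poly_Mapping.single e c) = h c * \<chi> e"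
  by (cases "c = 0") (auto simp: lext_def)

lemma lext_add:
  assumes "h 0 = 0" "\<And>x y. h (x + y) = h x + h y"
  shows "lext h \<chi> (f + g) = lext h \<chi> f + lext h \<chi> g"
proof -
  let ?A = "Poly_Mapping.keys f \<union> Poly_Mapping.keys g"
  have "Poly_Mapping.keys (f + g) \<subseteq> ?A" by (rule Poly_Mapping.keys_add)
  then show ?thesis
    by (simp add: lext_superset[of h ?A] assms lookup_add distrib_right sum.distrib)
qed

lemma laurent_induct [case_names single add]:
  fixes f :: "'a::comm_ring_1 laurent"
  assumes "\<And>e c. P (Poly_Mapping.single e c)" "\<And>f g. P f \<Longrightarrow> P g \<Longrightarrow> P (f + g)"
  shows "P f"
proof (induction f rule: update_induct)
  case const
  show ?case using assms(1)[of 0 0] by simp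
next
  case (update f a b)
  have "Poly_Mapping.update a b f = f + Poly_Mapping.single a b"
    using update(1) by (intro poly_mapping_eqI)
      (auto simp: lookup_update lookup_add lookup_single in_keys_iff when_def)
  then show ?case using assms update by simp
qed

lemma lext_mult:
  fixes f g :: "'a::comm_ring_1 laurent"
  assumes "h 0 = 0" "\<And>x y. h (x + y) = h x + h y" "\<And>x y. h (x * y) = h x * h y"
    and "\<And>d e. \<chi> (d + e) = \<chi> d * \<chi> e"
  shows "lext h \<chi> (f * g) = lext h \<chi> f * lext h \<chi> g"
proof (induction f rule: laurent_induct)
  case (single e c)
  show ?case
    by (induction g rule: laurent_induct)
      (simp_all add: mult_single lext_single assms(1,3,4) lext_add[OF assms(1,2)] distrib_left mult.assoc mult.left_commute)
qed (simp add: lext_add[OF assms(1,2)] distrib_right)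

lemma lext_one: "h 0 = 0 \<Longrightarrow> h 1 = 1 \<Longrightarrow> \<chi> 0 = 1 \<Longrightarrow> lext h \<chi> 1 = 1"
  using lext_single[of h \<chi> 0 1] by simp

lemma lext_minus:
  assumes "h 0 = 0" "\<And>x y. h (x + y) = h x + h y"
  shows "lext h \<chi> (- f) = - lext h \<chi> f"
  using lext_add[OF assms, of \<chi> "- f" f] by (simp add: eq_neg_iff_add_eq_0)

locale comm_ring_hom =
  fixes H :: "'r::comm_ring_1 \<Rightarrow> 's::comm_ring_1"
  assumes add: "H (f + g) = H f + H g" and mult: "H (f * g) = H f * H g" and one: "H 1 = 1"
begin

lemma zero: "H 0 = 0"
  using add[of 0 0] by simp

lemma minus: "H (- f) = - H f"
  using add[of "- f" f] by (simp add: eq_neg_iff_add_eq_0 zero)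

lemma diff: "H (f - g) = H f - H g"
  using add[of f "- g"] by (simp add: minus)

lemma prod: "H (\<Prod>i\<in>I. F i) = (\<Prod>i\<in>I. H (F i))"
  by (induction I rule: infinite_finite_induct) (simp_all add: one mult)

lemma power: "H (f ^ m) = H f ^ m"
  by (induction m) (simp_all add: one mult)

end

lemma comm_ring_hom_lext:
  assumes "comm_ring_hom h" "\<And>d e. \<chi> (d + e) = \<chi> d * \<chi> e" "\<chi> 0 = 1"
  shows "comm_ring_hom (lext h \<chi>)"
proof -
  interpret h: comm_ring_hom h by fact
  show ?thesis
    by unfold_locales (auto intro!: lext_add lext_mult lext_one simp: h.zero h.add h.mult h.one assms)
qed

abbreviation lfun :: "((nat \<Rightarrow>\<^sub>0 int) \<Rightarrow> 'a) \<Rightarrow> 'a::comm_ring_1 laurent \<Rightarrow> 'a"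
  where "lfun \<equiv> lext (\<lambda>x. x)"

lemma lfun_add: "lfun \<psi> (f + g) = lfun \<psi> f + lfun \<psi> g"
  by (rule lext_add) auto

lemma lfun_minus: "lfun \<psi> (- f) = - lfun \<psi> f"
  by (rule lext_minus) auto

lemma lfun_diff: "lfun \<psi> (f - g) = lfun \<psi> f - lfun \<psi> g"
  using lfun_add[of \<psi> f "- g"] by (simp add: lfun_minus)

lemma lfun_single_mult:
  "lfun \<psi> (Poly_Mapping.single d c * f) = c * lfun (\<lambda>e. \<psi> (d + e)) f"
  by (induction f rule: laurent_induct)
    (simp_all add: mult_single lext_single lfun_add distrib_left mult.assoc)

lemma lfun_sum: "lfun (\<lambda>e. \<Sum>x\<in>A. \<psi> x e) f = (\<Sum>x\<in>A. lfun (\<psi> x) f)"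
  unfolding lext_def sum_distrib_left by (rule sum.swap)

lemma lfun_scale: "lfun (\<lambda>e. c * \<psi> e) f = c * lfun \<psi> f"
  by (simp add: lext_def sum_distrib_left mult.left_commute)

lemma lfun_cong: "(\<And>e. e \<in> Poly_Mapping.keys f \<Longrightarrow> \<psi> e = \<psi>' e) \<Longrightarrow> lfun \<psi> f = lfun \<psi>' f"
  by (simp add: lext_def)

lemma lfun_eq_0: "(\<And>e. e \<in> Poly_Mapping.keys f \<Longrightarrow> \<psi> e = 0) \<Longrightarrow> lfun \<psi> f = 0"
  by (simp add: lext_def)

lemma constant_term_lfun: "constant_term f = lfun (\<lambda>e. if e = 0 then 1 else 0) f"
proof -
  have "lfun (\<lambda>e. if e = 0 then 1 else 0) f =
      (\<Sum>e\<in>Poly_Mapping.keys f. if e = 0 then Poly_Mapping.lookup f e else 0)"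
    unfolding lext_def by (intro sum.cong) auto
  then show ?thesis by (simp add: constant_term_def in_keys_iff)
qed

lemma constant_term_add: "constant_term (f + g) = constant_term f + constant_term g"
  by (simp add: constant_term_lfun lfun_add)

lemma constant_term_lconst: "constant_term (lconst c * f) = c * constant_term f"
  by (simp add: constant_term_lfun lconst_def lfun_single_mult)

lemma lconst_mult: "lconst (a * b) = lconst a * lconst b"
  by (simp add: lconst_def mult_single)

lemma comm_ring_hom_lconst: "comm_ring_hom lconst"
  by unfold_locales (auto simp: lconst_def mult_single Poly_Mapping.single_add)

section \<open>The pair factors and their binomials\<close>

definition zratio :: "nat \<Rightarrow> nat \<Rightarrow> nat \<Rightarrow>\<^sub>0 int"
  where "zratio i j = Poly_Mapping.single i 1 + Poly_Mapping.single j (-1)"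

lemma lvar_mult_inv: "lvar i * lvar_inv j = Poly_Mapping.single (zratio i j) 1"
  by (simp add: lvar_def lvar_inv_def mult_single zratio_def)

lemma lookup_zratio: "Poly_Mapping.lookup (zratio i j) l = of_bool (l = i) - of_bool (l = j)"
  by (auto simp: zratio_def lookup_add lookup_single when_def)

definition pairf :: "'a::comm_ring_1 \<Rightarrow> nat \<Rightarrow> nat \<Rightarrow> nat \<Rightarrow> 'a laurent"
  where "pairf q l i j = qpochhammer (lvar i * lvar_inv j) (lconst q) l *
     qpochhammer (lconst q * (lvar j * lvar_inv i)) (lconst q) l"

definition ordered_pairs :: "nat set \<Rightarrow> (nat \<times> nat) set"
  where "ordered_pairs V = {(i, j). i \<in> V \<and> j \<in> V \<and> i < j}"

lemma finite_ordered_pairs [simp, intro]: "finite V \<Longrightarrow> finite (ordered_pairs V)"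
  by (rule finite_subset[of _ "V \<times> V"]) (auto simp: ordered_pairs_def)

definition bino :: "'a::comm_ring_1 \<Rightarrow> nat \<Rightarrow> nat \<Rightarrow> 'a laurent"
  where "bino c i j = 1 - lconst c * (lvar i * lvar_inv j)"

lemma lconst_power: "lconst c ^ m = lconst (c ^ m)"
  using comm_ring_hom.power[OF comm_ring_hom_lconst, of c m] by simp

lemma pairf_bino: "pairf q l i j = (\<Prod>m<l. bino (q ^ m) i j) * (\<Prod>m<l. bino (q ^ Suc m) j i)"
  by (simp add: pairf_def qpochhammer_def bino_def lconst_power lconst_mult mult_ac)

text \<open>Adjoint of multiplication by a binomial: the factor moves from the Laurent polynomial to
  the weight. Factors are later absorbed or shown to vanish by this identity.\<close>

lemma lfun_bino:
  "lfun \<psi> (bino c i j * X) = lfun (\<lambda>e. \<psi> e - c * \<psi> (zratio i j + e)) X"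
proof -
  have "bino c i j * X = X - Poly_Mapping.single (zratio i j) c * X"
    by (simp add: bino_def lvar_mult_inv lconst_def mult_single left_diff_distrib)
  moreover have "lfun (\<lambda>e. \<psi> e - c * \<psi> (zratio i j + e)) X =
      lfun \<psi> X - c * lfun (\<lambda>e. \<psi> (zratio i j + e)) X"
    by (simp add: lext_def sum_subtractf sum_distrib_left algebra_simps)
  ultimately show ?thesis by (simp add: lfun_diff lfun_single_mult)
qed

lemma keys_bino: "Poly_Mapping.keys (bino c i j) \<subseteq> {0, zratio i j}"
proof -
  have "bino c i j = Poly_Mapping.single 0 1 - Poly_Mapping.single (zratio i j) c"
    by (simp add: bino_def lvar_mult_inv lconst_def mult_single)
  then show ?thesis
    by (auto simp: in_keys_iff lookup_minus lookup_single lookup_one when_def split: if_splits)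
qed

section \<open>Degree in a set of variables\<close>

definition wt :: "nat set \<Rightarrow> (nat \<Rightarrow>\<^sub>0 int) \<Rightarrow> int"
  where "wt S e = (\<Sum>j\<in>S. Poly_Mapping.lookup e j)"

lemma wt_0 [simp]: "wt S 0 = 0"
  by (simp add: wt_def)

lemma wt_add: "wt S (d + e) = wt S d + wt S e"
  by (simp add: wt_def lookup_add sum.distrib)

lemma wt_zratio: "finite S \<Longrightarrow> wt S (zratio i j) = of_bool (i \<in> S) - of_bool (j \<in> S)"
  by (simp add: wt_def lookup_zratio sum_subtractf of_bool_def)

lemma wt_prod_ge:
  fixes F :: "'i \<Rightarrow> 'a::comm_ring_1 laurent"
  assumes "\<And>i e. i \<in> I \<Longrightarrow> e \<in> Poly_Mapping.keys (F i) \<Longrightarrow> wt S e \<ge> B i"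
  shows "e \<in> Poly_Mapping.keys (\<Prod>i\<in>I. F i) \<Longrightarrow> wt S e \<ge> (\<Sum>i\<in>I. B i)"
  using assms
proof (induction I arbitrary: e rule: infinite_finite_induct)
  case (insert x I)
  from insert.prems(1) insert.hyps obtain a b where
    ab: "e = a + b" "a \<in> Poly_Mapping.keys (F x)" "b \<in> Poly_Mapping.keys (\<Prod>i\<in>I. F i)"
    using keys_mult[of "F x" "\<Prod>i\<in>I. F i"] by auto
  have "wt S a \<ge> B x" "wt S b \<ge> (\<Sum>i\<in>I. B i)"
    using insert.prems(2) insert.IH ab by auto
  then show ?case using insert.hyps by (simp add: ab wt_add)
qed (auto simp: keys_one split: if_splits)

text \<open>A ratio of two variables changes the degree in \<open>S\<close> only if \<open>S\<close>
  separates them; then just one of the two q-shifted factorials can lower it, by one for each of its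
  \<open>l\<close> binomials.\<close>

lemma wt_pairf_ge:
  fixes q :: "'a::comm_ring_1"
  assumes "finite S" "e \<in> Poly_Mapping.keys (pairf q l i j)"
  shows "wt S e \<ge> - int l * of_bool ((i \<in> S) \<noteq> (j \<in> S))"
proof -
  obtain a b where ab: "e = a + b" "a \<in> Poly_Mapping.keys (\<Prod>m<l. bino (q ^ m) i j)"
      "b \<in> Poly_Mapping.keys (\<Prod>m<l. bino (q ^ Suc m) j i)"
    using assms(2) unfolding pairf_bino using keys_mult by blast
  have "wt S d \<ge> - of_bool (i \<notin> S \<and> j \<in> S)" if "d \<in> Poly_Mapping.keys (bino c i j)"
    for c :: 'a and d i j
    using that keys_bino[of c i j] assms(1) by (auto simp: wt_zratio)
  note bino = this
  have "wt S a \<ge> (\<Sum>m<l. - of_bool (i \<notin> S \<and> j \<in> S))"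
      "wt S b \<ge> (\<Sum>m<l. - of_bool (j \<notin> S \<and> i \<in> S))"
    by (rule wt_prod_ge[OF _ ab(2)], erule bino, rule wt_prod_ge[OF _ ab(3)], erule bino)
  then show ?thesis by (auto simp: ab wt_add split: if_splits)
qed

lemma keys_prod_closed:
  fixes F :: "'i \<Rightarrow> 'a::comm_ring_1 laurent"
  assumes "P 0" "\<And>d e. P d \<Longrightarrow> P e \<Longrightarrow> P (d + e)"
    and "\<And>i e. i \<in> I \<Longrightarrow> e \<in> Poly_Mapping.keys (F i) \<Longrightarrow> P e"
  shows "e \<in> Poly_Mapping.keys (\<Prod>i\<in>I. F i) \<Longrightarrow> P e"
  using assms(3)
proof (induction I arbitrary: e rule: infinite_finite_induct)
  case (insert x I)
  from insert.prems(1) insert.hyps obtain a b where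
    ab: "e = a + b" "a \<in> Poly_Mapping.keys (F x)" "b \<in> Poly_Mapping.keys (\<Prod>i\<in>I. F i)"
    using keys_mult[of "F x" "\<Prod>i\<in>I. F i"] by auto
  have "P a" using insert.prems(2) ab by auto
  moreover have "P b" using insert.prems(2) by (intro insert.IH[OF ab(3)]) auto
  ultimately show ?case using ab(1) assms(2) by simp
qed (auto simp: assms(1) split: if_splits)

lemma keys_mult_closed:
  fixes f g :: "'a::comm_ring_1 laurent"
  assumes "\<And>d e. P d \<Longrightarrow> P e \<Longrightarrow> P (d + e)"
    and "\<And>e. e \<in> Poly_Mapping.keys f \<Longrightarrow> P e" "\<And>e. e \<in> Poly_Mapping.keys g \<Longrightarrow> P e"
  shows "e \<in> Poly_Mapping.keys (f * g) \<Longrightarrow> P e"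
  using keys_mult[of f g] assms by blast

section \<open>Homogeneity of degree zero\<close>

definition balanced :: "nat set \<Rightarrow> (nat \<Rightarrow>\<^sub>0 int) \<Rightarrow> bool"
  where "balanced V e \<longleftrightarrow> wt V e = 0 \<and> Poly_Mapping.keys e \<subseteq> V"

lemma balanced_0: "balanced V 0"
  by (simp add: balanced_def)

lemma balanced_add: "balanced V d \<Longrightarrow> balanced V e \<Longrightarrow> balanced V (d + e)"
  using Poly_Mapping.keys_add[of d e] by (auto simp: balanced_def wt_add)

lemma balanced_zratio: "finite V \<Longrightarrow> i \<in> V \<Longrightarrow> j \<in> V \<Longrightarrow> balanced V (zratio i j)"
  by (auto simp: balanced_def wt_zratio in_keys_iff lookup_zratio of_bool_def split: if_splits)

lemma balanced_keys_prod:
  fixes F :: "'i \<Rightarrow> 'a::comm_ring_1 laurent"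
  assumes "\<And>i e. i \<in> I \<Longrightarrow> e \<in> Poly_Mapping.keys (F i) \<Longrightarrow> balanced V e"
    and "e \<in> Poly_Mapping.keys (\<Prod>i\<in>I. F i)"
  shows "balanced V e"
  by (rule keys_prod_closed[of "balanced V", OF balanced_0 _ _ assms(2)]) (auto intro: balanced_add assms(1))

lemma balanced_keys_mult:
  fixes f g :: "'a::comm_ring_1 laurent"
  assumes "\<And>e. e \<in> Poly_Mapping.keys f \<Longrightarrow> balanced V e" "\<And>e. e \<in> Poly_Mapping.keys g \<Longrightarrow> balanced V e"
    and "e \<in> Poly_Mapping.keys (f * g)"
  shows "balanced V e"
  by (rule keys_mult_closed[of "balanced V", OF _ _ _ assms(3)]) (auto intro: balanced_add assms(1,2))

lemma balanced_keys_bino: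
  "finite V \<Longrightarrow> i \<in> V \<Longrightarrow> j \<in> V \<Longrightarrow> e \<in> Poly_Mapping.keys (bino c i j) \<Longrightarrow> balanced V e"
  using keys_bino[of c i j] balanced_zratio[of V i j] balanced_0[of V] by auto

lemma balanced_pairf:
  fixes q :: "'a::comm_ring_1"
  assumes "finite V" "i \<in> V" "j \<in> V" "e \<in> Poly_Mapping.keys (pairf q l i j)"
  shows "balanced V e"
  using assms(4) unfolding pairf_bino
  by (rule balanced_keys_mult[rotated -1]; elim balanced_keys_prod[rotated -1])
    (use assms(1-3) in \<open>auto elim!: balanced_keys_bino[rotated -1] simp del: power_Suc\<close>)

text \<open>The length of a pair factor. Label 0 belongs to the n_0 variables outside the blocks, so
  equal labels lengthen the pair only from label 1 on.\<close>

definition lam :: "nat \<Rightarrow> (nat \<Rightarrow> nat) \<Rightarrow> nat \<Rightarrow> nat \<Rightarrow> nat"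
  where "lam k blk i j = k + of_bool (blk i = blk j \<and> blk i \<ge> 1)"

definition inner_prod :: "'a::comm_ring_1 \<Rightarrow> nat \<Rightarrow> (nat \<Rightarrow> nat) \<Rightarrow> nat set \<Rightarrow> 'a laurent"
  where "inner_prod q k blk V = (\<Prod>(i, j)\<in>ordered_pairs V. pairf q (lam k blk i j) i j)"

text \<open>Degree zero serves three purposes: it bounds the degree in \<open>q ^ a\<close>, it
  identifies the value at \<open>a = 0\<close>, and it lets the extra variable be forgotten.\<close>

lemma balanced_inner_prod:
  assumes "finite V" "e \<in> Poly_Mapping.keys (inner_prod q k blk V)"
  shows "balanced V e"
  using assms(2) unfolding inner_prod_def
  by (rule balanced_keys_prod[rotated -1])
    (auto simp: ordered_pairs_def intro: balanced_pairf assms(1))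

text \<open>A separated pair has its member of \<open>S\<close> in either position; flipping the
  pairs of the second kind yields each element of \<open>S\<close> times its complement exactly
  once.\<close>

lemma sum_split_pairs:
  fixes f :: "nat \<Rightarrow> nat \<Rightarrow> int"
  assumes "finite V" "S \<subseteq> V" "\<And>i j. f i j = f j i"
  shows "(\<Sum>(i, j)\<in>ordered_pairs V. f i j * of_bool ((i \<in> S) \<noteq> (j \<in> S))) = (\<Sum>s\<in>S. \<Sum>r\<in>V - S. f r s)"
proof -
  let ?A = "{(i, j)\<in>ordered_pairs V. i \<in> S \<and> j \<notin> S}"
  let ?B = "{(i, j)\<in>ordered_pairs V. i \<notin> S \<and> j \<in> S}"
  have fin: "finite ?A" "finite ?B"
    using finite_ordered_pairs[OF assms(1)] by (auto elim!: rev_finite_subset)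
  have "(\<Sum>(i, j)\<in>ordered_pairs V. f i j * of_bool ((i \<in> S) \<noteq> (j \<in> S))) = (\<Sum>(i, j)\<in>?A \<union> ?B. f i j)"
    using assms(1) by (intro sum.mono_neutral_cong_right) auto
  also have "\<dots> = (\<Sum>(i, j)\<in>?A. f i j) + (\<Sum>(i, j)\<in>?B. f i j)"
    using fin by (intro sum.union_disjoint) auto
  also have "(\<Sum>(i, j)\<in>?B. f i j) = (\<Sum>(i, j)\<in>prod.swap ` ?B. f i j)"
    by (subst sum.reindex) (auto simp: assms(3) intro!: sum.cong)
  also have "(\<Sum>(i, j)\<in>?A. f i j) + (\<Sum>(i, j)\<in>prod.swap ` ?B. f i j) = (\<Sum>(i, j)\<in>?A \<union> prod.swap ` ?B. f i j)"
    using fin by (intro sum.union_disjoint[symmetric]) (auto simp: ordered_pairs_def)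
  also have "?A \<union> prod.swap ` ?B = S \<times> (V - S)"
    using assms(2) by (fastforce simp: ordered_pairs_def image_iff not_less_iff_gr_or_eq)
  also have "(\<Sum>(i, j)\<in>S \<times> (V - S). f i j) = (\<Sum>s\<in>S. \<Sum>r\<in>V - S. f r s)"
    using assms by (simp add: sum.cartesian_product)
  finally show ?thesis .
qed

lemma wt_inner_prod_ge:
  assumes "finite V" "S \<subseteq> V" "e \<in> Poly_Mapping.keys (inner_prod q k blk V)"
  shows "wt S e \<ge> - (\<Sum>s\<in>S. \<Sum>r\<in>V - S. int (lam k blk r s))"
proof -
  have S: "finite S" using assms finite_subset by blast
  have "wt S e \<ge> (\<Sum>x\<in>ordered_pairs V. case x of (i, j) \<Rightarrow> - int (lam k blk i j) * of_bool ((i \<in> S) \<noteq> (j \<in> S)))"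
    by (rule wt_prod_ge[OF _ assms(3)[unfolded inner_prod_def]]) (auto dest!: wt_pairf_ge[OF S])
  also have "(\<Sum>x\<in>ordered_pairs V. case x of (i, j) \<Rightarrow> - int (lam k blk i j) * of_bool ((i \<in> S) \<noteq> (j \<in> S))) =
      - (\<Sum>(i, j)\<in>ordered_pairs V. int (lam k blk i j) * of_bool ((i \<in> S) \<noteq> (j \<in> S)))"
    by (simp add: sum_negf[symmetric] case_prod_unfold)
  also have "\<dots> = - (\<Sum>s\<in>S. \<Sum>r\<in>V - S. int (lam k blk r s))"
    by (subst sum_split_pairs[OF assms(1,2)]) (auto simp: lam_def)
  finally show ?thesis .
qed

section \<open>Analytic continuation of the one-variable coefficients\<close>

text \<open>
  \<open>phi q b e\<close>, evaluated at \<open>q ^ a\<close>, is the coefficient of \<open>x\<^sup>e\<close> in \<open>(q x; q)\<^sub>a (1 / x; q)\<^sub>b\<close>.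
  It is a polynomial in \<open>q ^ a\<close>, so that \<open>a\<close> may be continued to negative values.
\<close>

definition phi0 :: "'a::field \<Rightarrow> int \<Rightarrow> 'a poly"
  where "phi0 q e = (if e < 0 then 0 else \<Prod>i<nat e. smult (q / (1 - q ^ Suc i)) [:- (q ^ i), 1:])"

primrec phi :: "'a::field \<Rightarrow> nat \<Rightarrow> int \<Rightarrow> 'a poly" where
  "phi q 0 e = phi0 q e"
| "phi q (Suc b) e = phi q b e - smult (q ^ b) (phi q b (e + 1))"

lemma phi_eq_0: "int b + e < 0 \<Longrightarrow> phi q b e = 0"
  by (induction b arbitrary: e) (auto simp: phi0_def)

text \<open>Each new factor of (1 / x; q)_b brings in only the coefficient with index
  \<open>e + 1\<close>, so it raises the degree by at most one.\<close>

lemma degree_phi: "degree (phi q b e) \<le> nat (int b + e)"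
proof (induction b arbitrary: e)
  case 0
  have "degree (\<Prod>i<nat e. smult (q / (1 - q ^ Suc i)) [:- (q ^ i), 1:]) \<le> (\<Sum>i<nat e. 1)"
  proof (rule order_trans[OF degree_prod_sum_le[OF finite_lessThan]], unfold o_def, rule sum_mono)
    show "degree (smult (q / (1 - q ^ Suc i)) [:- (q ^ i), 1:]) \<le> 1" for i
      by (rule order_trans[OF degree_smult_le]) simp
  qed
  then show ?case by (simp add: phi0_def)
next
  case (Suc b)
  have "degree (phi q b e) \<le> nat (int (Suc b) + e)"
    by (rule order_trans[OF Suc]) auto
  moreover have "degree (smult (q ^ b) (phi q b (e + 1))) \<le> nat (int (Suc b) + e)"
    by (rule order_trans[OF degree_smult_le order_trans[OF Suc]]) auto
  ultimately show ?case by (simp add: degree_diff_le)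
qed

lemma poly_phi0_1: "poly (phi0 q e) 1 = of_bool (e = 0)"
proof (cases "e > 0")
  case True
  then have "\<exists>i\<in>{..<nat e}. poly (smult (q / (1 - q ^ Suc i)) [:- (q ^ i), 1:]) 1 = 0"
    by (intro bexI[of _ 0]) auto
  then show ?thesis using True by (auto simp: phi0_def poly_prod)
qed (auto simp: phi0_def)

text \<open>At a = 0 only (1 / x; q)_b is left, a polynomial in 1 / x with constant term 1. For
  negative \<open>e\<close> its coefficients need not vanish.\<close>

lemma poly_phi_1:
  assumes "e \<ge> 0"
  shows "poly (phi q b e) 1 = of_bool (e = 0)"
  using assms by (induction b arbitrary: e) (auto simp: poly_phi0_1)

lemma phi0_Suc: "phi0 q (int (Suc m)) = phi0 q (int m) * smult (q / (1 - q ^ Suc m)) [:- (q ^ m), 1:]"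
proof -
  have "nat (int (Suc m)) = Suc m" "nat (int m) = m" "\<not> int (Suc m) < 0" "\<not> int m < 0" by auto
  then show ?thesis unfolding phi0_def by (simp del: of_nat_Suc)
qed

locale generic_q =
  fixes q :: "'a::field"
  assumes q_nz: "q \<noteq> 0" and q_root: "m \<ge> 1 \<Longrightarrow> q ^ m \<noteq> 1"
begin

text \<open>With \<open>u = q ^ a\<close> this is (q x; q)_(a+1) = (1 - q^(a+1) x) (q x; q)_a read
  off at x^e; the product defining \<open>phi0\<close> is the q-binomial theorem for (q x; q)_a,
  written in \<open>u\<close>.\<close>

lemma phi0_shift:
  "poly (phi0 q e) (u * q) = poly (phi0 q e) u - q * u * poly (phi0 q (e - 1)) u"
proof (cases "e \<ge> 1")
  case False
  then show ?thesis by (auto simp: phi0_def)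
next
  case True
  have "poly (phi0 q (int (Suc m))) (u * q) =
      poly (phi0 q (int (Suc m))) u - q * u * poly (phi0 q (int m)) u" for m
  proof (induction m)
    case 0
    have "1 - q \<noteq> 0" using q_root[of 1] by simp
    then show ?case by (simp add: phi0_def) (simp add: field_simps)
  next
    case (Suc m)
    let ?P = "poly (phi0 q (int m)) u"
    have nz: "1 - q ^ Suc m \<noteq> 0" "1 - q ^ Suc (Suc m) \<noteq> 0"
      using q_root[of "Suc m"] q_root[of "Suc (Suc m)"] by auto
    have 1: "poly (phi0 q (int (Suc m))) u = ?P * (q / (1 - q ^ Suc m) * (u - q ^ m))"
      by (subst phi0_Suc) (simp del: power_Suc add: right_diff_distrib diff_divide_distrib mult_ac)
    have 2: "poly (phi0 q (int (Suc (Suc m)))) v =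
        poly (phi0 q (int (Suc m))) v * (q / (1 - q ^ Suc (Suc m)) * (v - q ^ Suc m))" for v
      by (subst phi0_Suc) (simp del: power_Suc of_nat_Suc add: right_diff_distrib diff_divide_distrib mult_ac)
    have "poly (phi0 q (int (Suc (Suc m)))) (u * q) =
        (poly (phi0 q (int (Suc m))) u - q * u * ?P) * (q / (1 - q ^ Suc (Suc m)) * (u * q - q ^ Suc m))"
      by (simp only: 2 Suc)
    also have "\<dots> = poly (phi0 q (int (Suc m))) u * (q / (1 - q ^ Suc (Suc m)) * (u - q ^ Suc m))
        - q * u * poly (phi0 q (int (Suc m))) u"
    proof -
      define A where "A = 1 - q ^ Suc m"
      define C where "C = 1 - q ^ Suc (Suc m)"
      have [simp]: "A \<noteq> 0" "C \<noteq> 0" using nz by (auto simp: A_def C_def)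
      define X where "X = q / A"
      define Y where "Y = q / C"
      define v where "v = q ^ m"
      have XA: "X * A = q" and YC: "Y * C = q" by (auto simp: X_def Y_def)
      have e: "A = 1 - q * v" "C = 1 - q * (q * v)" by (auto simp: A_def C_def v_def)
      have "((X * (u - v) - q * u) * (Y * (u * q - q * v)) -
          (X * (u - v) * (Y * (u - q * v)) - q * u * (X * (u - v)))) * (A * C) =
          (X * A * (u - v) - q * u * A) * ((Y * C) * (u * q - q * v)) -
          (X * A * (u - v) * (Y * C * (u - q * v)) - q * u * (X * A * (u - v)) * C)"
        by algebra
      also have "\<dots> = 0" unfolding XA YC unfolding e by algebra
      finally have "(X * (u - v) - q * u) * (Y * (u * q - q * v)) =
          X * (u - v) * (Y * (u - q * v)) - q * u * (X * (u - v))" by simp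
      then have "(q / A * (u - q ^ m) - q * u) * (q / C * (u * q - q ^ Suc m)) =
          q / A * (u - q ^ m) * (q / C * (u - q ^ Suc m)) - q * u * (q / A * (u - q ^ m))"
        by (simp add: X_def Y_def v_def)
      moreover have "(P * a - c * P) * K = P * a * L - c * (P * a)"
        if "(a - c) * K = a * L - c * a" for P a c K L :: 'a
        using that by algebra
      ultimately show ?thesis unfolding 1 A_def C_def by blast
    qed
    finally show ?case by (simp only: 2[of u])
  qed
  from this[of "nat (e - 1)"] True show ?thesis by (simp add: add.commute)
qed

text \<open>Partial fractions of 1 / ((1 - x) (1 - x / q) ... (1 - x / q^(h - 1))). The formula
  reaches below 0, where the left side is zero, because the fraction decays like x^(-h) at
  infinity.\<close>

lemma phi0_neg:
  "\<exists>\<omega>. \<forall>e > - int h. poly (phi0 q e) (inverse q ^ h) = (\<Sum>i<h. \<omega> i * (inverse q ^ i) powi e)"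
proof (induction h)
  case 0
  then show ?case by (auto simp: poly_phi0_1)
next
  case (Suc h)
  define r where "r = inverse q"
  have rq [simp]: "r * q = 1" "q * r = 1" and r_nz [simp]: "r \<noteq> 0" using q_nz by (auto simp: r_def)
  obtain \<omega> where \<omega>: "\<And>e. e > - int h \<Longrightarrow> poly (phi0 q e) (r ^ h) = (\<Sum>i<h. \<omega> i * (r ^ i) powi e)"
    using Suc by (auto simp: r_def)
  \<comment> \<open>Dividing by 1 - r^h x multiplies the term with ratio \<open>r ^ i\<close> by 1 /
    (1 - r^h q^i), since \<open>(r ^ i) powi (e - 1)\<close> is
    \<open>(r ^ i) powi e * q ^ i\<close>.\<close>
  define \<omega>' where "\<omega>' i = \<omega> i / (1 - r ^ h * q ^ i)" for i
  define d where "d e = poly (phi0 q e) (r ^ Suc h) - (\<Sum>i<h. \<omega>' i * (r ^ i) powi e)" for e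
  have nz: "1 - r ^ h * q ^ i \<noteq> 0" if "i < h" for i
  proof
    assume "1 - r ^ h * q ^ i = 0"
    then have "r ^ h * q ^ i = 1" by (metis eq_iff_diff_eq_0)
    then have "q ^ (h - i) * (r ^ h * q ^ i) = q ^ (h - i)" by simp
    moreover have "q ^ (h - i) * (r ^ h * q ^ i) = q ^ (h - i + i) * r ^ h"
      unfolding power_add by (simp only: mult_ac)
    moreover have "q ^ (h - i + i) * r ^ h = (q * r) ^ h"
      using that by (simp only: power_mult_distrib) simp
    ultimately show False using q_root[of "h - i"] that by simp
  qed
  have d_rec: "d e = r ^ h * d (e - 1)" if "e > - int h" for e
  proof -
    have "poly (phi0 q e) (r ^ h) = poly (phi0 q e) (r ^ Suc h) - r ^ h * poly (phi0 q (e - 1)) (r ^ Suc h)"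
    proof -
      have "r ^ Suc h * q = r ^ h * (r * q)" "q * r ^ Suc h = r ^ h * (q * r)"
        by (simp_all only: power_Suc mult_ac)
      then have "r ^ Suc h * q = r ^ h" "q * r ^ Suc h = r ^ h" by simp_all
      then show ?thesis using phi0_shift[of e "r ^ Suc h"] by (simp only:)
    qed
    moreover have "(\<Sum>i<h. \<omega>' i * (r ^ i) powi e) - r ^ h * (\<Sum>i<h. \<omega>' i * (r ^ i) powi (e - 1)) =
        (\<Sum>i<h. \<omega> i * (r ^ i) powi e)"
      unfolding sum_distrib_left sum_subtractf[symmetric]
    proof (rule sum.cong[OF refl])
      fix i assume "i \<in> {..<h}"
      then have "1 - r ^ h * q ^ i \<noteq> 0" using nz by auto
      moreover have "(r ^ i) powi (e - 1) = (r ^ i) powi e * q ^ i"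
        by (simp add: power_int_diff) (simp add: r_def field_simps q_nz)
      moreover have "\<omega>' i * (r ^ i) powi e - r ^ h * (\<omega>' i * ((r ^ i) powi e * q ^ i)) =
          \<omega>' i * (1 - r ^ h * q ^ i) * (r ^ i) powi e" by algebra
      ultimately show "\<omega>' i * (r ^ i) powi e - r ^ h * (\<omega>' i * (r ^ i) powi (e - 1)) =
          \<omega> i * (r ^ i) powi e"
        by (simp add: \<omega>'_def)
    qed
    ultimately show ?thesis using \<omega>[OF that] by (simp add: d_def algebra_simps)
  qed
  \<comment> \<open>The difference solves the homogeneous recurrence, so it is geometric from
    \<open>- int h\<close> on. This is the contribution of the new pole, and starting at
    \<open>- int h\<close> extends the range of validity by one.\<close>
  have d_eq: "d e = d (- int h) * (r ^ h) powi (e + int h)" if "e \<ge> - int h" for e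
    using that
  proof (induction e rule: int_ge_induct)
    case (step i)
    have "d (i + 1) = r ^ h * d i" using d_rec[of "i + 1"] step by simp
    moreover have "(r ^ h) powi (i + 1 + int h) = r ^ h * (r ^ h) powi (i + int h)"
      using power_int_add_1[of "r ^ h" "i + int h"] by (simp add: add_ac mult_ac)
    ultimately show ?case using step by simp
  qed simp
  let ?w = "\<omega>'(h := d (- int h) * (r ^ h) powi (int h))"
  have "poly (phi0 q e) (r ^ Suc h) = (\<Sum>i<Suc h. ?w i * (r ^ i) powi e)" if "e > - int (Suc h)" for e
  proof -
    have "(\<Sum>i<h. ?w i * (r ^ i) powi e) = (\<Sum>i<h. \<omega>' i * (r ^ i) powi e)"
      by (rule sum.cong) auto
    moreover have "d e = ?w h * (r ^ h) powi e"
      using d_eq[of e] that by (simp add: power_int_add mult_ac)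
    ultimately show ?thesis by (simp add: d_def algebra_simps)
  qed
  then show ?case unfolding r_def[symmetric] by (intro exI[of _ ?w] allI impI)
qed

text \<open>Each factor \<open>1 - q ^ b / x\<close> of \<open>(1 / x; q)\<^sub>b\<close> kills the pole of \<open>1 / (q ^ (1 - h) x; q)\<^sub>h\<close> at \<open>x = q ^ b\<close>.\<close>

lemma phi_neg:
  "\<exists>\<omega>. \<forall>e > - int h. poly (phi q b e) (inverse q ^ h) =
     (\<Sum>i\<in>{b..<h}. \<omega> i * (inverse q ^ i) powi e)"
proof (induction b)
  case 0
  then show ?case using phi0_neg[of h] by (simp add: atLeast0LessThan)
next
  case (Suc b)
  define r where "r = inverse q"
  have r_nz [simp]: "r \<noteq> 0" using q_nz by (auto simp: r_def)
  obtain \<omega> where \<omega>: "\<And>e. e > - int h \<Longrightarrow>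
      poly (phi q b e) (r ^ h) = (\<Sum>i\<in>{b..<h}. \<omega> i * (r ^ i) powi e)"
    using Suc by (auto simp: r_def)
  have "poly (phi q (Suc b) e) (r ^ h) =
      (\<Sum>i\<in>{Suc b..<h}. (\<omega> i * (1 - q ^ b * r ^ i)) * (r ^ i) powi e)" if "e > - int h" for e
  proof -
    have "poly (phi q (Suc b) e) (r ^ h) = (\<Sum>i\<in>{b..<h}. (\<omega> i * (1 - q ^ b * r ^ i)) * (r ^ i) powi e)"
      using that \<omega>[of e] \<omega>[of "e + 1"]
      by (simp add: sum_distrib_left power_int_add_1' flip: sum_subtractf)
        (simp add: algebra_simps)
    also have "\<dots> = (\<Sum>i\<in>{Suc b..<h}. (\<omega> i * (1 - q ^ b * r ^ i)) * (r ^ i) powi e)"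
    proof (rule sum.mono_neutral_right)
      have "q ^ b * r ^ b = 1" by (simp add: r_def q_nz power_inverse)
      moreover have "i = b" if "i \<in> {b..<h} - {Suc b..<h}" for i using that by auto
      ultimately show "\<forall>i\<in>{b..<h} - {Suc b..<h}. \<omega> i * (1 - q ^ b * r ^ i) * (r ^ i) powi e = 0"
        by fastforce
    qed auto
    finally show ?thesis .
  qed
  then show ?case unfolding r_def[symmetric]
    by (intro exI[of _ "\<lambda>i. \<omega> i * (1 - q ^ b * r ^ i)"] allI impI)
qed

end

section \<open>Points at which the integrand does not vanish\<close>

text \<open>One functional per variable, so that evaluation in some variables can be combined with
  arbitrary weights in the others.\<close>

definition mw :: "nat set \<Rightarrow> (nat \<Rightarrow> int \<Rightarrow> 'a::comm_ring_1) \<Rightarrow> (nat \<Rightarrow>\<^sub>0 int) \<Rightarrow> 'a"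
  where "mw V \<Phi> e = (\<Prod>j\<in>V. \<Phi> j (Poly_Mapping.lookup e j))"

lemma mw_shift:
  assumes "finite V" "i \<in> V" "j \<in> V" "i \<noteq> j"
  shows "mw V \<Phi> (zratio i j + e) = \<Phi> i (Poly_Mapping.lookup e i + 1) * \<Phi> j (Poly_Mapping.lookup e j - 1) *
    (\<Prod>l\<in>V - {i, j}. \<Phi> l (Poly_Mapping.lookup e l))"
proof -
  have V: "V = insert i (insert j (V - {i, j}))" using assms by auto
  have "(\<Prod>l\<in>V - {i, j}. \<Phi> l (Poly_Mapping.lookup (zratio i j + e) l)) =
      (\<Prod>l\<in>V - {i, j}. \<Phi> l (Poly_Mapping.lookup e l))"
    by (rule prod.cong) (auto simp: lookup_add lookup_zratio)
  then show ?thesis unfolding mw_def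
    using assms by (subst V) (simp add: lookup_add lookup_zratio mult.assoc add.commute)
qed

lemma mw_split:
  assumes "finite V" "i \<in> V" "j \<in> V" "i \<noteq> j"
  shows "mw V \<Phi> e = \<Phi> i (Poly_Mapping.lookup e i) * \<Phi> j (Poly_Mapping.lookup e j) *
    (\<Prod>l\<in>V - {i, j}. \<Phi> l (Poly_Mapping.lookup e l))"
proof -
  have V: "V = insert i (insert j (V - {i, j}))" using assms by auto
  show ?thesis unfolding mw_def
    using assms by (subst V) (simp add: mult.assoc)
qed

text \<open>The two power weights evaluate z_i at \<open>x\<close> and z_j at \<open>y\<close>,
  where 1 - c z_i / z_j is zero. The weights of the other variables are arbitrary, which is what
  partial evaluation needs.\<close>

lemma lfun_mw_bino_eq_0:
  fixes x y c :: "'a::field"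
  assumes "finite V" "i \<in> V" "j \<in> V" "i \<noteq> j" "\<Phi> i = (\<lambda>e. x powi e)" "\<Phi> j = (\<lambda>e. y powi e)"
    and "x \<noteq> 0" "y \<noteq> 0" "c * x = y"
  shows "lfun (mw V \<Phi>) (bino c i j * X) = 0"
proof -
  have "mw V \<Phi> e - c * mw V \<Phi> (zratio i j + e) = 0" for e
  proof -
    let ?a = "Poly_Mapping.lookup e i" and ?b = "Poly_Mapping.lookup e j"
    have "c * (x powi (?a + 1) * y powi (?b - 1)) = (c * x / y) * (x powi ?a * y powi ?b)"
      using assms(7,8) by (simp add: power_int_add power_int_diff)
    then have "c * (x powi (?a + 1) * y powi (?b - 1)) = x powi ?a * y powi ?b"
      using assms(8,9) by simp
    then show ?thesis
      unfolding mw_shift[OF assms(1-4)] unfolding mw_split[OF assms(1-4)] assms(5,6)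
      by (simp add: mult.assoc[symmetric])
  qed
  then show ?thesis unfolding lfun_bino by (intro lfun_eq_0)
qed

text \<open>
  A lower bound for the largest exponent of a point \<open>(q ^ (- \<iota> j))\<close> at which no pair factor vanishes.
  Listing the indices by increasing \<open>\<iota>\<close>, each step costs at least \<open>k\<close>, and at least \<open>k + 1\<close> if
  the index increases or the block is kept; the indicator of \<open>blk x \<le> \<alpha>\<close> records whether the current
  run of decreasing indices may already have met the block \<open>\<alpha>\<close>.
\<close>

lemma exponent_spread:
  fixes \<iota> blk :: "nat \<Rightarrow> nat"
  assumes "finite R" "R \<noteq> {}" "k \<ge> 1" "\<alpha> \<ge> 1"
    and "\<And>i j. i \<in> R \<Longrightarrow> j \<in> R \<Longrightarrow> i \<le> j \<Longrightarrow> blk i \<le> blk j"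
    and "\<And>j. j \<in> R \<Longrightarrow> k + of_bool (blk j = p) \<le> \<iota> j" "\<And>j. j \<in> R \<Longrightarrow> blk j \<le> p"
    and "\<And>i j. i \<in> R \<Longrightarrow> j \<in> R \<Longrightarrow> i < j \<Longrightarrow>
          \<iota> i + lam k blk i j < \<iota> j \<or> \<iota> j + lam k blk i j \<le> \<iota> i"
  shows "\<exists>x\<in>R. (\<forall>y\<in>R. \<iota> y \<le> \<iota> x) \<and>
     k * card R + card {j\<in>R. blk j = \<alpha>} + of_bool (\<alpha> = p) \<le> \<iota> x + of_bool (blk x \<le> \<alpha>)"
  using assms(1,2,5-8)
proof (induction R rule: finite_ranking_induct[where f = \<iota>])
  case empty
  then show ?case by simp
next
  case (insert x S)
  show ?case
  proof (cases "x \<in> S")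
    case True
    then have S: "insert x S = S" by blast
    then have "S \<noteq> {}" by blast
    from insert.IH[OF this insert.prems(2-5)[unfolded S]] show ?thesis unfolding S .
  next
    case x: False
    have card: "card {j\<in>insert x S. blk j = \<alpha>} = card {j\<in>S. blk j = \<alpha>} + of_bool (blk x = \<alpha>)"
    proof (cases "blk x = \<alpha>")
      case True
      then have "{j\<in>insert x S. blk j = \<alpha>} = insert x {j\<in>S. blk j = \<alpha>}" by auto
      then show ?thesis using insert.hyps x True by simp
    next
      case False
      then have "{j\<in>insert x S. blk j = \<alpha>} = {j\<in>S. blk j = \<alpha>}" by auto
      then show ?thesis using False by simp
    qed
    show ?thesis
    proof (cases "S = {}")
      case True
      have "k + of_bool (blk x = p) \<le> \<iota> x" using insert.prems(3)[of x] by simp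
      moreover have "blk x \<le> p" using insert.prems(4)[of x] by simp
      ultimately show ?thesis using True by (intro bexI[of _ x]) (auto simp: of_bool_def Collect_conv_if)
    next
      case False
      obtain m where m: "m \<in> S" "\<forall>y\<in>S. \<iota> y \<le> \<iota> m"
        "k * card S + card {j\<in>S. blk j = \<alpha>} + of_bool (\<alpha> = p) \<le> \<iota> m + of_bool (blk m \<le> \<alpha>)"
        using insert.IH[OF False insert.prems(2-5)] by auto
      have le: "\<iota> m \<le> \<iota> x" using insert.hyps m by auto
      have "m \<noteq> x" using x m by auto
      \<comment> \<open>The hypothesis on pairs is strict when the larger exponent has the larger
        index, which gives the extra unit; otherwise an equal block gives it through
        \<open>lam\<close>.\<close>
      have step: "\<iota> m + k + of_bool (m < x \<or> blk m = blk x \<and> blk x \<ge> 1) \<le> \<iota> x"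
      proof (cases "m < x")
        case True
        then have "\<iota> m + lam k blk m x < \<iota> x"
          using insert.prems(5)[of m x] m le assms(3) by (auto simp: lam_def)
        then show ?thesis using True by (auto simp: lam_def)
      next
        case False
        then have "x < m" using \<open>m \<noteq> x\<close> by auto
        then have "\<iota> m + lam k blk x m \<le> \<iota> x"
          using insert.prems(5)[of x m] m le by auto
        then show ?thesis using False by (auto simp: lam_def)
      qed
      have mono: "m < x" if "blk m < blk x"
        using insert.prems(2)[of x m] m that by (meson insertCI leD leI)
      \<comment> \<open>A rise of the block pays a unit, since the index rises with it. Without a
        rise, a point of block \<alpha> preceded by one of block at most \<alpha> is preceded by one
        of block \<alpha> itself, and the equality of blocks pays; this uses
        \<open>\<alpha> \<ge> 1\<close>.\<close>
      have "of_bool (blk x = \<alpha>) + of_bool (blk m \<le> \<alpha>) \<le>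
          of_bool (m < x \<or> blk m = blk x \<and> blk x \<ge> 1) + (of_bool (blk x \<le> \<alpha>) :: nat)"
        using mono assms(4) by (cases "blk m < blk x") auto
      moreover have "k * card (insert x S) = k * card S + k" using insert.hyps(1) x by simp
      ultimately have "k * card (insert x S) + card {j\<in>insert x S. blk j = \<alpha>} + of_bool (\<alpha> = p) \<le>
          \<iota> x + of_bool (blk x \<le> \<alpha>)"
        using m(3) step unfolding card by linarith
      moreover have "\<forall>y\<in>insert x S. \<iota> y \<le> \<iota> x" using insert.hyps by auto
      ultimately show ?thesis by blast
    qed
  qed
qed

text \<open>The excluded differences are those at which a binomial of the pair vanishes: 1 - q^m z_i
  / z_j for m = \<iota> i - \<iota> j in 0, ..., l - 1, and 1 - q^m z_j / z_i for m = \<iota> j -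
  \<iota> i in 1, ..., l.\<close>

lemma lfun_inner_prod_eq_0:
  fixes q :: "'a::field" and \<iota> :: "nat \<Rightarrow> nat"
  assumes "finite V" "i \<in> V" "j \<in> V" "i < j" "q \<noteq> 0"
    and "\<Phi> i = (\<lambda>e. (inverse q ^ \<iota> i) powi e)" "\<Phi> j = (\<lambda>e. (inverse q ^ \<iota> j) powi e)"
    and "\<not> (\<iota> i + lam k blk i j < \<iota> j \<or> \<iota> j + lam k blk i j \<le> \<iota> i)"
  shows "lfun (mw V \<Phi>) (inner_prod q k blk V) = 0"
proof -
  let ?l = "lam k blk i j"
  have "(i, j) \<in> ordered_pairs V" using assms by (auto simp: ordered_pairs_def)
  from dvd_prodI[OF finite_ordered_pairs[OF assms(1)] this, of "\<lambda>(i, j). pairf q (lam k blk i j) i j"]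
  have dvd: "pairf q ?l i j dvd inner_prod q k blk V"
    by (simp add: inner_prod_def)
  have pw: "q ^ m * inverse q ^ n = inverse q ^ n'" if "m + n' = n" for m n n'
    using assms(5) by (simp add: power_add field_simps flip: that)
  have "bino (q ^ m) i j dvd inner_prod q k blk V" if "m < ?l" for m
    by (rule dvd_trans[OF _ dvd], unfold pairf_bino) (rule dvd_mult2, rule dvd_prodI, use that in auto)
  moreover have "bino (q ^ Suc m) j i dvd inner_prod q k blk V" if "m < ?l" for m
    by (rule dvd_trans[OF _ dvd], unfold pairf_bino) (rule dvd_mult, rule dvd_prodI, use that in auto)
  moreover have "\<iota> i - \<iota> j < ?l \<and> \<iota> j \<le> \<iota> i \<or> \<iota> j - \<iota> i - 1 < ?l \<and> \<iota> i < \<iota> j"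
    using assms(8) by linarith
  ultimately consider Y where "\<iota> j \<le> \<iota> i" "inner_prod q k blk V = bino (q ^ (\<iota> i - \<iota> j)) i j * Y"
    | Y where "\<iota> i < \<iota> j" "inner_prod q k blk V = bino (q ^ Suc (\<iota> j - \<iota> i - 1)) j i * Y"
    by (metis dvdE)
  then show ?thesis
  proof cases
    case 1
    show ?thesis unfolding 1(2)
    proof (rule lfun_mw_bino_eq_0[OF assms(1-3) _ assms(6,7)])
      show "q ^ (\<iota> i - \<iota> j) * inverse q ^ \<iota> i = inverse q ^ \<iota> j"
        using 1(1) by (intro pw) auto
    qed (use assms(4,5) in auto)
  next
    case 2
    show ?thesis unfolding 2(2)
    proof (rule lfun_mw_bino_eq_0[OF assms(1,3,2) _ assms(7,6)])
      show "q ^ Suc (\<iota> j - \<iota> i - 1) * inverse q ^ \<iota> j = inverse q ^ \<iota> i"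
        using 2(1) by (intro pw) auto
    qed (use assms(4,5) in auto)
  qed
qed

section \<open>The constant term as a polynomial in \<open>q ^ a\<close>\<close>

locale dyson_blocks = generic_q q for q :: "'a::field" +
  fixes V :: "nat set" and k p :: nat and blk :: "nat \<Rightarrow> nat"
  assumes fin_V: "finite V" and k_ge: "k \<ge> 1" and p_ge: "p \<ge> 1"
    and blk_mono: "i \<in> V \<Longrightarrow> j \<in> V \<Longrightarrow> i \<le> j \<Longrightarrow> blk i \<le> blk j"
    and blk_le: "j \<in> V \<Longrightarrow> blk j \<le> p"
    and card_blk: "\<alpha> \<in> {1..p} \<Longrightarrow> card {j\<in>V. blk j = \<alpha>} \<le> card {j\<in>V. blk j = p}"
begin

abbreviation inner where "inner \<equiv> inner_prod q k blk V"

definition bexp :: "nat \<Rightarrow> nat"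
  where "bexp j = k + of_bool (blk j = p)"

definition total :: nat
  where "total = (\<Sum>j\<in>V. bexp j)"

lemma total_eq: "total = k * card V + card {j\<in>V. blk j = p}"
  using fin_V by (simp add: total_def bexp_def sum.distrib of_bool_def sum.If_cases Int_def mult.commute)

text \<open>The polynomial F in u = q^a, written without the extra variable w, whose exponent is
  determined by the others.\<close>

definition ct_poly :: "'a poly"
  where "ct_poly = (\<Sum>e\<in>Poly_Mapping.keys inner.
     smult (Poly_Mapping.lookup inner e) (\<Prod>j\<in>V. phi q (bexp j) (Poly_Mapping.lookup e j)))"

lemma poly_ct_poly: "poly ct_poly u = lfun (mw V (\<lambda>j e. poly (phi q (bexp j) e) u)) inner"
  by (simp add: ct_poly_def lext_def mw_def poly_sum poly_prod)

text \<open>The exponents of \<open>inner\<close> sum to zero, so the bounds b_j + e_j add up to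
  \<open>total\<close>. If one of them is negative the whole term is zero, hence the truncation by
  \<open>nat\<close> does no harm.\<close>

lemma degree_ct_poly: "degree ct_poly \<le> total"
  unfolding ct_poly_def
proof (rule degree_sum_le, simp, rule order_trans[OF degree_smult_le])
  fix e assume "e \<in> Poly_Mapping.keys inner"
  then have wt: "(\<Sum>j\<in>V. Poly_Mapping.lookup e j) = 0"
    using balanced_inner_prod[OF fin_V] by (auto simp: balanced_def wt_def)
  show "degree (\<Prod>j\<in>V. phi q (bexp j) (Poly_Mapping.lookup e j)) \<le> total"
  proof (cases "\<exists>j\<in>V. int (bexp j) + Poly_Mapping.lookup e j < 0")
    case True
    then have "(\<Prod>j\<in>V. phi q (bexp j) (Poly_Mapping.lookup e j)) = 0"
      using fin_V phi_eq_0 by (auto intro: prod_zero)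
    then show ?thesis by simp
  next
    case False
    have "degree (\<Prod>j\<in>V. phi q (bexp j) (Poly_Mapping.lookup e j)) \<le>
        (\<Sum>j\<in>V. nat (int (bexp j) + Poly_Mapping.lookup e j))"
      by (rule order_trans[OF degree_prod_sum_le[OF fin_V]]) (auto intro!: sum_mono degree_phi)
    also have "int \<dots> = (\<Sum>j\<in>V. int (bexp j) + Poly_Mapping.lookup e j)"
      unfolding of_nat_sum using False by (intro sum.cong) (auto simp: not_less)
    then have "(\<Sum>j\<in>V. nat (int (bexp j) + Poly_Mapping.lookup e j)) = total"
      by (simp add: sum.distrib wt total_def flip: of_nat_sum)
    finally show ?thesis .
  qed
qed

lemma poly_ct_poly_1: "poly ct_poly 1 = constant_term inner"
  unfolding poly_ct_poly constant_term_lfun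
proof (rule lfun_cong)
  fix e assume "e \<in> Poly_Mapping.keys inner"
  then have e: "(\<Sum>j\<in>V. Poly_Mapping.lookup e j) = 0" "Poly_Mapping.keys e \<subseteq> V"
    using balanced_inner_prod[OF fin_V, of e q k blk] by (simp_all add: balanced_def wt_def)
  show "mw V (\<lambda>j e. poly (phi q (bexp j) e) 1) e = (if e = 0 then 1 else 0)"
  proof (cases "e = 0")
    case True
    then show ?thesis by (simp add: mw_def poly_phi_1)
  next
    case False
    \<comment> \<open>\<open>poly_phi_1\<close> is silent about negative exponents, so a positive
      one is needed to kill the term.\<close>
    have "\<exists>j\<in>V. Poly_Mapping.lookup e j > 0"
    proof (rule ccontr)
      assume "\<not> ?thesis"
      then have "\<forall>j\<in>V. Poly_Mapping.lookup e j = 0"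
        using e(1) fin_V sum_nonneg_eq_0_iff[of V "\<lambda>j. - Poly_Mapping.lookup e j"]
        by (auto simp: not_less sum_negf)
      then have "e = 0" using e(2) by (intro poly_mapping_eqI) (auto simp: in_keys_iff)
      then show False using False by simp
    qed
    then obtain j where "j \<in> V" "Poly_Mapping.lookup e j > 0" by blast
    then show ?thesis
      using False fin_V by (auto simp: mw_def poly_phi_1 intro!: bexI[of _ j])
  qed
qed

lemma sum_lam:
  assumes "finite R"
  shows "(\<Sum>r\<in>R. lam k blk r j) = k * card R + (if blk j \<ge> 1 then card {r\<in>R. blk r = blk j} else 0)"
proof -
  have "{r\<in>R. blk r = blk j \<and> blk r \<ge> 1} = (if blk j \<ge> 1 then {r\<in>R. blk r = blk j} else {})"
    by auto
  then show ?thesis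
    using assms by (simp add: lam_def sum.distrib of_bool_def sum.If_cases Int_def mult.commute)
qed

text \<open>
  The variables in \<open>R\<close> are evaluated at negative powers of \<open>q\<close>; in the others only exponents
  \<open>\<le> -h\<close> are seen, which lie below the total degree of \<open>inner\<close> in these variables.
\<close>

lemma lfun_inner_partial:
  assumes h: "1 \<le> h" "h \<le> total" and R: "R \<subseteq> V"
    and \<iota>: "\<And>j. j \<in> R \<Longrightarrow> bexp j \<le> \<iota> j" "\<And>j. j \<in> R \<Longrightarrow> \<iota> j < h"
    and \<Phi>: "\<And>j. j \<in> R \<Longrightarrow> \<Phi> j = (\<lambda>e. (inverse q ^ \<iota> j) powi e)"
    and Z: "\<And>j e. j \<in> V - R \<Longrightarrow> e > - int h \<Longrightarrow> \<Phi> j e = 0"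
  shows "lfun (mw V \<Phi>) inner = 0"
proof (cases "\<exists>i\<in>R. \<exists>j\<in>R. i < j \<and> \<not> (\<iota> i + lam k blk i j < \<iota> j \<or> \<iota> j + lam k blk i j \<le> \<iota> i)")
  case True
  then obtain i j where ij: "i \<in> R" "j \<in> R" "i < j"
    "\<not> (\<iota> i + lam k blk i j < \<iota> j \<or> \<iota> j + lam k blk i j \<le> \<iota> i)" by blast
  show ?thesis
    by (rule lfun_inner_prod_eq_0[OF fin_V _ _ ij(3) q_nz \<Phi>[OF ij(1)] \<Phi>[OF ij(2)] ij(4)]) (use ij R in auto)
next
  case False
  have fin_R: "finite R" using R fin_V finite_subset by blast
  \<comment> \<open>The strict bound \<open>\<iota> x < h\<close> absorbs the indicator of
    \<open>blk x \<le> \<alpha>\<close>.\<close>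
  have spread: "k * card R + card {j\<in>R. blk j = \<alpha>} + of_bool (\<alpha> = p) \<le> h"
    if "R \<noteq> {}" "\<alpha> \<ge> 1" for \<alpha>
  proof -
    have "\<exists>x\<in>R. (\<forall>y\<in>R. \<iota> y \<le> \<iota> x) \<and>
        k * card R + card {j\<in>R. blk j = \<alpha>} + of_bool (\<alpha> = p) \<le> \<iota> x + of_bool (blk x \<le> \<alpha>)"
    proof (rule exponent_spread[OF fin_R that(1) k_ge that(2)])
      show "blk i \<le> blk j" if "i \<in> R" "j \<in> R" "i \<le> j" for i j
        using blk_mono that R by blast
      show "k + of_bool (blk j = p) \<le> \<iota> j" if "j \<in> R" for j
        using \<iota>(1)[OF that] by (simp add: bexp_def)
      show "blk j \<le> p" if "j \<in> R" for j
        using blk_le that R by blast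
      show "\<iota> i + lam k blk i j < \<iota> j \<or> \<iota> j + lam k blk i j \<le> \<iota> i"
        if "i \<in> R" "j \<in> R" "i < j" for i j
        using False that by blast
    qed
    then obtain x where "x \<in> R"
      "k * card R + card {j\<in>R. blk j = \<alpha>} + of_bool (\<alpha> = p) \<le> \<iota> x + of_bool (blk x \<le> \<alpha>)" by blast
    moreover have "of_bool (blk x \<le> \<alpha>) \<le> (1::nat)" by simp
    ultimately show ?thesis using \<iota>(2)[of x] by linarith
  qed
  have "R \<noteq> V"
  proof
    assume "R = V"
    moreover have "V \<noteq> {}" using h by (auto simp: total_def)
    ultimately have "total + 1 \<le> h" using spread[of p] p_ge by (simp add: total_eq)
    then show False using h by simp
  qed
  then have ne: "V - R \<noteq> {}" using R by auto
  \<comment> \<open>Strictness comes from the unit for \<open>\<alpha> = p\<close>: directly if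
    \<open>j\<close> lies in block p, and for label 0 because there every point of \<open>R\<close>
    costs only \<open>k\<close>.\<close>
  have le: "(\<Sum>r\<in>R. lam k blk r j) \<le> h" and lt: "blk j \<in> {0, p} \<Longrightarrow> (\<Sum>r\<in>R. lam k blk r j) < h"
    if "j \<in> V - R" for j
  proof -
    consider "R = {}" | "R \<noteq> {}" "blk j = 0" | "R \<noteq> {}" "blk j \<ge> 1" by linarith
    then have "(\<Sum>r\<in>R. lam k blk r j) \<le> h \<and> (blk j \<in> {0, p} \<longrightarrow> (\<Sum>r\<in>R. lam k blk r j) < h)"
    proof cases
      case 1
      then show ?thesis using h by simp
    next
      case 2
      then show ?thesis using spread[of p] p_ge by (simp add: sum_lam[OF fin_R])
    next
      case 3
      then show ?thesis using spread[of "blk j"] by (auto simp: sum_lam[OF fin_R])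
    qed
    then show "(\<Sum>r\<in>R. lam k blk r j) \<le> h" "blk j \<in> {0, p} \<Longrightarrow> (\<Sum>r\<in>R. lam k blk r j) < h" by auto
  qed
  \<comment> \<open>All these sums are at most \<open>h\<close>; a single strict one makes the total
    over \<open>V - R\<close> strict.\<close>
  have "\<exists>j\<in>V - R. (\<Sum>r\<in>R. lam k blk r j) < h"
  proof (cases "\<exists>j\<in>V - R. blk j \<in> {0, p}")
    case True
    then show ?thesis using lt by blast
  next
    case no: False
    obtain j where j: "j \<in> V - R" using ne by blast
    then have bj: "blk j \<ge> 1" "blk j \<le> p" using no blk_le by (auto simp: Suc_le_eq)
    show ?thesis
    proof (cases "R = {}")
      case True
      then show ?thesis using j h by auto
    next
      case False
      \<comment> \<open>Here all of block p lies in \<open>R\<close>. As the largest block it has at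
        least as many points in \<open>R\<close> as the block of \<open>j\<close>, so the strict
        bound for block p carries over.\<close>
      have "card {r\<in>R. blk r = blk j} \<le> card {r\<in>V. blk r = blk j}"
        using R fin_V by (intro card_mono) auto
      also have "\<dots> \<le> card {r\<in>V. blk r = p}" using bj by (intro card_blk) auto
      also have "{r\<in>V. blk r = p} = {r\<in>R. blk r = p}" using no R by auto
      finally have "(\<Sum>r\<in>R. lam k blk r j) < h"
        using spread[OF False p_ge] bj by (simp add: sum_lam[OF fin_R])
      then show ?thesis using j by blast
    qed
  qed
  then have "(\<Sum>j\<in>V - R. \<Sum>r\<in>R. lam k blk r j) < (\<Sum>j\<in>V - R. h)"
    using fin_V le by (intro sum_strict_mono_ex1) auto
  then have small: "(\<Sum>j\<in>V - R. \<Sum>r\<in>R. int (lam k blk r j)) < (\<Sum>j\<in>V - R. int h)"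
    by (simp only: of_nat_less_iff flip: of_nat_sum)
  show ?thesis
  proof (rule lfun_eq_0)
    fix e assume e: "e \<in> Poly_Mapping.keys inner"
    have "V - (V - R) = R" using R by auto
    then have "- (\<Sum>j\<in>V - R. int h) < wt (V - R) e"
      using wt_inner_prod_ge[OF fin_V _ e, of "V - R"] small by auto
    then have *: "(\<Sum>j\<in>V - R. - int h) < (\<Sum>j\<in>V - R. Poly_Mapping.lookup e j)"
      unfolding wt_def sum_negf .
    have "\<exists>j\<in>V - R. Poly_Mapping.lookup e j > - int h"
    proof (rule ccontr)
      assume "\<not> ?thesis"
      then have "(\<Sum>j\<in>V - R. Poly_Mapping.lookup e j) \<le> (\<Sum>j\<in>V - R. - int h)"
        by (intro sum_mono) (auto simp: not_less)
      then show False using * by linarith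
    qed
    then show "mw V \<Phi> e = 0" using Z fin_V by (auto simp: mw_def intro!: prod_zero)
  qed
qed

lemma ct_poly_zero:
  assumes h: "1 \<le> h" "h \<le> total"
  shows "poly ct_poly (inverse q ^ h) = 0"
proof -
  have "\<forall>j. \<exists>\<omega>. \<forall>e > - int h. poly (phi q (bexp j) e) (inverse q ^ h) =
      (\<Sum>i\<in>{bexp j..<h}. \<omega> i * (inverse q ^ i) powi e)"
    by (intro allI phi_neg)
  from choice[OF this] obtain \<omega> where
    "\<forall>j. \<forall>e > - int h. poly (phi q (bexp j) e) (inverse q ^ h) =
      (\<Sum>i\<in>{bexp j..<h}. \<omega> j i * (inverse q ^ i) powi e)" by blast
  then have \<omega>: "poly (phi q (bexp j) e) (inverse q ^ h) =
      (\<Sum>i\<in>{bexp j..<h}. \<omega> j i * (inverse q ^ i) powi e)" if "e > - int h" for j e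
    using that by blast
  define E where "E j i e = \<omega> j i * (inverse q ^ i) powi e" for j i e
  define Z where "Z j e = poly (phi q (bexp j) e) (inverse q ^ h) - (\<Sum>i\<in>{bexp j..<h}. E j i e)" for j e
  define \<Psi> where "\<Psi> R \<iota> j = (if j \<in> R then \<lambda>e. (inverse q ^ \<iota> j) powi e else Z j)" for R and \<iota> :: "nat \<Rightarrow> nat" and j
  let ?I = "\<lambda>R. PiE R (\<lambda>j. {bexp j..<h})"
  have "mw V (\<lambda>j e. poly (phi q (bexp j) e) (inverse q ^ h)) e =
      (\<Sum>R\<in>Pow V. \<Sum>\<iota>\<in>?I R. (\<Prod>j\<in>R. \<omega> j (\<iota> j)) * mw V (\<Psi> R \<iota>) e)" for e
  proof -
    let ?e = "Poly_Mapping.lookup e"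
    have "mw V (\<lambda>j e. poly (phi q (bexp j) e) (inverse q ^ h)) e =
        (\<Prod>j\<in>V. (\<Sum>i\<in>{bexp j..<h}. E j i (?e j)) + Z j (?e j))"
      by (simp add: mw_def Z_def)
    also have "\<dots> = (\<Sum>R\<in>Pow V. (\<Prod>j\<in>R. \<Sum>i\<in>{bexp j..<h}. E j i (?e j)) * (\<Prod>j\<in>V - R. Z j (?e j)))"
      by (rule prod_add[OF fin_V])
    also have "\<dots> = (\<Sum>R\<in>Pow V. \<Sum>\<iota>\<in>?I R. (\<Prod>j\<in>R. \<omega> j (\<iota> j)) * mw V (\<Psi> R \<iota>) e)"
    proof (rule sum.cong[OF refl])
      fix R assume "R \<in> Pow V"
      then have R: "R \<subseteq> V" "finite R" using fin_V finite_subset by auto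
      have "(\<Prod>j\<in>R. \<Sum>i\<in>{bexp j..<h}. E j i (?e j)) = (\<Sum>\<iota>\<in>?I R. \<Prod>j\<in>R. E j (\<iota> j) (?e j))"
        by (rule prod_sum_PiE) (use R in auto)
      moreover have "(\<Prod>j\<in>R. E j (\<iota> j) (?e j)) * (\<Prod>j\<in>V - R. Z j (?e j)) =
          (\<Prod>j\<in>R. \<omega> j (\<iota> j)) * mw V (\<Psi> R \<iota>) e" for \<iota>
      proof -
        have "mw V (\<Psi> R \<iota>) e = (\<Prod>j\<in>V - R. \<Psi> R \<iota> j (?e j)) * (\<Prod>j\<in>R. \<Psi> R \<iota> j (?e j))"
          unfolding mw_def by (rule prod.subset_diff[OF R(1) fin_V])
        also have "\<dots> = (\<Prod>j\<in>V - R. Z j (?e j)) * (\<Prod>j\<in>R. (inverse q ^ \<iota> j) powi (?e j))"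
          by (intro arg_cong2[of _ _ _ _ "(*)"] prod.cong) (auto simp: \<Psi>_def)
        finally show ?thesis by (simp add: E_def prod.distrib)
      qed
      ultimately show "(\<Prod>j\<in>R. \<Sum>i\<in>{bexp j..<h}. E j i (?e j)) * (\<Prod>j\<in>V - R. Z j (?e j)) =
          (\<Sum>\<iota>\<in>?I R. (\<Prod>j\<in>R. \<omega> j (\<iota> j)) * mw V (\<Psi> R \<iota>) e)"
        by (simp add: sum_distrib_right)
    qed
    finally show ?thesis .
  qed
  then have "poly ct_poly (inverse q ^ h) =
      (\<Sum>R\<in>Pow V. \<Sum>\<iota>\<in>?I R. (\<Prod>j\<in>R. \<omega> j (\<iota> j)) * lfun (mw V (\<Psi> R \<iota>)) inner)"
    unfolding poly_ct_poly by (simp add: lfun_sum lfun_scale cong: lfun_cong)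
  also have "\<dots> = 0"
  proof (intro sum.neutral ballI)
    fix R \<iota> assume R: "R \<in> Pow V" and \<iota>: "\<iota> \<in> ?I R"
    have bounds: "bexp j \<le> \<iota> j" "\<iota> j < h" if "j \<in> R" for j
      using PiE_mem[OF \<iota> that] by auto
    have "lfun (mw V (\<Psi> R \<iota>)) inner = 0"
    proof (rule lfun_inner_partial[OF h])
      show "\<Psi> R \<iota> j e = 0" if "j \<in> V - R" "e > - int h" for j e
        using that \<omega>[OF that(2), of j] by (simp add: \<Psi>_def Z_def E_def)
    qed (use R bounds in \<open>auto simp: \<Psi>_def\<close>)
    then show "(\<Prod>j\<in>R. \<omega> j (\<iota> j)) * lfun (mw V (\<Psi> R \<iota>)) inner = 0" by simp
  qed
  finally show ?thesis .
qed

text \<open>Cross-multiplied, because the constant term is shown to be nonzero only for the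
  indeterminate.\<close>

lemma ct_poly_eq:
  "poly ct_poly (q ^ a) * (\<Prod>h=1..total. 1 - q ^ h) = constant_term inner * (\<Prod>h=1..total. 1 - q ^ (a + h))"
proof -
  have inj: "inj_on (\<lambda>h. inverse q ^ h) {0..total}"
  proof (rule linorder_inj_onI)
    fix x y :: nat assume "x < y"
    show "inverse q ^ x \<noteq> inverse q ^ y"
    proof
      assume "inverse q ^ x = inverse q ^ y"
      moreover have "y = x + (y - x)" using \<open>x < y\<close> by simp
      ultimately have "inverse q ^ x * 1 = inverse q ^ x * inverse q ^ (y - x)"
        by (metis mult.right_neutral power_add)
      then have "q ^ (y - x) = 1" using q_nz by (simp add: power_inverse)
      then show False using q_root[of "y - x"] \<open>x < y\<close> by simp
    qed
  qed auto
  define Q where "Q = (\<Prod>h=1..total. [:1, - (q ^ h):])"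
  have Q: "poly Q u = (\<Prod>h=1..total. 1 - q ^ h * u)" for u
    by (simp add: Q_def poly_prod mult.commute)
  \<comment> \<open>The scaling makes both parts agree at u = 1. With the common zeros this gives
    \<open>total + 1\<close> roots of a polynomial of degree at most \<open>total\<close>.\<close>
  define P where "P = smult (poly Q 1) ct_poly - smult (poly ct_poly 1) Q"
  have "degree Q \<le> (\<Sum>h=1..total. 1)"
    unfolding Q_def by (rule order_trans[OF degree_prod_sum_le]) (auto intro!: sum_mono simp del: sum_constant)
  then have deg: "degree P \<le> total"
    unfolding P_def
    by (intro degree_diff_le order_trans[OF degree_smult_le]) (auto simp: degree_ct_poly)
  have "poly P (inverse q ^ h) = 0" if "h \<in> {0..total}" for h
  proof (cases "h = 0")
    case True
    then show ?thesis by (simp add: P_def)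
  next
    case False
    then have "poly Q (inverse q ^ h) = 0"
      unfolding Q using that q_nz by (intro prod_zero) (auto simp: power_inverse intro!: bexI[of _ h])
    then show ?thesis using ct_poly_zero[of h] False that by (simp add: P_def)
  qed
  then have sub: "(\<lambda>h. inverse q ^ h) ` {0..total} \<subseteq> {x. poly P x = 0}" by auto
  have "P = 0"
  proof (rule ccontr)
    assume "P \<noteq> 0"
    then have "card ((\<lambda>h. inverse q ^ h) ` {0..total}) \<le> degree P"
      using card_mono[OF poly_roots_finite sub] card_poly_roots_bound[of P] by linarith
    then show False using deg card_image[OF inj] by simp
  qed
  then have "poly P (q ^ a) = 0" by simp
  then show ?thesis
    by (simp add: P_def Q poly_ct_poly_1 power_add mult_ac)
qed

end

section \<open>Absorbing the factors that contain the extra variable\<close>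

lemma mw_fun_upd:
  assumes "finite V" "j \<in> V"
  shows "mw V (\<Phi>(j := \<phi>)) e = \<phi> (Poly_Mapping.lookup e j) * (\<Prod>l\<in>V - {j}. \<Phi> l (Poly_Mapping.lookup e l))"
proof -
  have "(\<Prod>l\<in>V - {j}. (\<Phi>(j := \<phi>)) l (Poly_Mapping.lookup e l)) =
      (\<Prod>l\<in>V - {j}. \<Phi> l (Poly_Mapping.lookup e l))"
    by (rule prod.cong) auto
  then show ?thesis unfolding mw_def using assms by (subst prod.remove[of V j]) auto
qed

text \<open>\<open>mw V\<close> gives \<open>w\<close> no weight, so a ratio with \<open>w\<close>
  shifts the exponent of \<open>j\<close> alone, as if \<open>w\<close> were 1.\<close>

lemma lfun_mw_bino:
  fixes c :: "'a::comm_ring_1"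
  assumes "finite V" "j \<in> V" "w \<notin> V"
  shows "lfun (mw V (\<Phi>(j := \<phi>))) (bino c j w * X) = lfun (mw V (\<Phi>(j := \<lambda>e. \<phi> e - c * \<phi> (e + 1)))) X"
    and "lfun (mw V (\<Phi>(j := \<phi>))) (bino c w j * X) = lfun (mw V (\<Phi>(j := \<lambda>e. \<phi> e - c * \<phi> (e - 1)))) X"
proof -
  have rest: "(\<Prod>l\<in>V - {j}. \<Phi> l (Poly_Mapping.lookup (d + e) l)) = (\<Prod>l\<in>V - {j}. \<Phi> l (Poly_Mapping.lookup e l))"
    if "d = zratio j w \<or> d = zratio w j" for d e
    using that assms by (intro prod.cong) (auto simp: lookup_add lookup_zratio)
  have "j \<noteq> w" using assms by auto
  then show "lfun (mw V (\<Phi>(j := \<phi>))) (bino c j w * X) = lfun (mw V (\<Phi>(j := \<lambda>e. \<phi> e - c * \<phi> (e + 1)))) X"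
    unfolding lfun_bino mw_fun_upd[OF assms(1,2)]
    by (intro lfun_cong) (simp add: rest, simp add: lookup_add lookup_zratio algebra_simps)
  show "lfun (mw V (\<Phi>(j := \<phi>))) (bino c w j * X) = lfun (mw V (\<Phi>(j := \<lambda>e. \<phi> e - c * \<phi> (e - 1)))) X"
    using \<open>j \<noteq> w\<close> unfolding lfun_bino mw_fun_upd[OF assms(1,2)]
    by (intro lfun_cong) (simp add: rest, simp add: lookup_add lookup_zratio algebra_simps)
qed

context generic_q
begin

text \<open>The weight on the left extracts exponent 0, the case a = b = 0. Each binomial in w / z_j
  then raises a by one through \<open>phi0_shift\<close>, and each one in z_j / w raises b by one
  through the recursion of \<open>phi\<close>.\<close>

lemma lfun_mw_kernel:
  assumes "finite V" "j \<in> V" "w \<notin> V"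
  shows "lfun (mw V (\<Phi>(j := \<lambda>e. poly (phi0 q e) 1)))
      ((\<Prod>m<a. bino (q ^ Suc m) w j) * ((\<Prod>m<b. bino (q ^ m) j w) * X)) =
    lfun (mw V (\<Phi>(j := \<lambda>e. poly (phi q b e) (q ^ a)))) X"
proof -
  have up: "lfun (mw V (\<Phi>(j := \<lambda>e. poly (phi0 q e) 1))) ((\<Prod>m<a. bino (q ^ Suc m) w j) * X) =
    lfun (mw V (\<Phi>(j := \<lambda>e. poly (phi0 q e) (q ^ a)))) X" for X
  proof (induction a arbitrary: X)
    case (Suc a)
    have "lfun (mw V (\<Phi>(j := \<lambda>e. poly (phi0 q e) 1))) ((\<Prod>m<Suc a. bino (q ^ Suc m) w j) * X) =
        lfun (mw V (\<Phi>(j := \<lambda>e. poly (phi0 q e) (q ^ a)))) (bino (q ^ Suc a) w j * X)"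
      using Suc[of "bino (q ^ Suc a) w j * X"] by (simp only: prod.lessThan_Suc mult.assoc)
    also have "\<dots> = lfun (mw V (\<Phi>(j := \<lambda>e. poly (phi0 q e) (q ^ a * q)))) X"
      by (simp only: lfun_mw_bino(2)[OF assms] phi0_shift power_Suc)
    finally show ?case by (simp only: power_Suc2)
  qed simp
  have down: "lfun (mw V (\<Phi>(j := \<lambda>e. poly (phi0 q e) (q ^ a)))) ((\<Prod>m<b. bino (q ^ m) j w) * X) =
    lfun (mw V (\<Phi>(j := \<lambda>e. poly (phi q b e) (q ^ a)))) X" for X
  proof (induction b arbitrary: X)
    case (Suc b)
    have "lfun (mw V (\<Phi>(j := \<lambda>e. poly (phi0 q e) (q ^ a)))) ((\<Prod>m<Suc b. bino (q ^ m) j w) * X) =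
        lfun (mw V (\<Phi>(j := \<lambda>e. poly (phi q b e) (q ^ a)))) (bino (q ^ b) j w * X)"
      using Suc[of "bino (q ^ b) j w * X"] by (simp only: prod.lessThan_Suc mult.assoc)
    then show ?case by (simp only: lfun_mw_bino(1)[OF assms] phi.simps poly_diff poly_smult)
  qed simp
  show ?thesis by (simp only: up down)
qed

end

text \<open>Once the exponents on \<open>V\<close> vanish, degree zero forces that of
  \<open>w\<close> to vanish too, so \<open>w\<close> needs no weight.\<close>

lemma constant_term_balanced:
  fixes q :: "'a::field" and f :: "'a laurent"
  assumes "finite V" "w \<notin> V" "\<And>e. e \<in> Poly_Mapping.keys f \<Longrightarrow> balanced (insert w V) e"
  shows "constant_term f = lfun (mw V (\<lambda>j e. poly (phi0 q e) 1)) f"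
  unfolding constant_term_lfun
proof (rule lfun_cong)
  fix e assume "e \<in> Poly_Mapping.keys f"
  then have e: "Poly_Mapping.lookup e w + wt V e = 0" "Poly_Mapping.keys e \<subseteq> insert w V"
    using assms by (auto simp: balanced_def wt_def)
  show "(if e = 0 then 1 else 0) = mw V (\<lambda>j e. poly (phi0 q e) 1) e"
  proof (cases "\<forall>j\<in>V. Poly_Mapping.lookup e j = 0")
    case True
    then have "wt V e = 0" by (simp add: wt_def)
    then have "Poly_Mapping.lookup e j = 0" for j
      using True e by (cases "j = w") (auto simp: in_keys_iff)
    then have "e = 0" by (intro poly_mapping_eqI) simp
    then show ?thesis by (simp add: mw_def poly_phi0_1)
  next
    case False
    then have "e \<noteq> 0" by auto
    then show ?thesis using False assms(1) by (auto simp: mw_def poly_phi0_1)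
  qed
qed

context dyson_blocks
begin

definition kernel :: "nat \<Rightarrow> nat \<Rightarrow> nat \<Rightarrow> 'a laurent"
  where "kernel a w j = (\<Prod>m<a. bino (q ^ Suc m) w j) * (\<Prod>m<bexp j. bino (q ^ m) j w)"

lemma constant_term_kernel:
  assumes "w \<notin> V"
  shows "constant_term ((\<Prod>j\<in>V. kernel a w j) * inner) = poly ct_poly (q ^ a)"
proof -
  let ?\<Psi> = "\<lambda>j e. poly (phi q (bexp j) e) (q ^ a)"
  \<comment> \<open>Variables are converted one at a time: those in \<open>U\<close> still carry
    plain extraction together with their kernel.\<close>
  let ?\<Phi> = "\<lambda>U j. if j \<in> U then \<lambda>e. poly (phi0 q e) 1 else ?\<Psi> j"
  have step: "lfun (mw V (?\<Phi> U)) ((\<Prod>j\<in>U. kernel a w j) * X) = lfun (mw V ?\<Psi>) X" if "U \<subseteq> V" for U X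
  proof -
    have "finite U" using that fin_V finite_subset by blast
    then show ?thesis using that
    proof (induction U arbitrary: X)
      case (insert u U)
      have 1: "?\<Phi> (insert u U) = (?\<Phi> U)(u := \<lambda>e. poly (phi0 q e) 1)" by auto
      have 2: "?\<Phi> U = (?\<Phi> U)(u := ?\<Psi> u)" using insert.hyps by auto
      have "lfun (mw V (?\<Phi> (insert u U))) ((\<Prod>j\<in>insert u U. kernel a w j) * X) =
          lfun (mw V ((?\<Phi> U)(u := \<lambda>e. poly (phi0 q e) 1))) (kernel a w u * ((\<Prod>j\<in>U. kernel a w j) * X))"
        unfolding 1 using insert.hyps by (simp add: mult.assoc)
      also have "\<dots> = lfun (mw V ((?\<Phi> U)(u := ?\<Psi> u))) ((\<Prod>j\<in>U. kernel a w j) * X)"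
        unfolding kernel_def mult.assoc using insert.prems
        by (intro lfun_mw_kernel fin_V assms) auto
      also have "\<dots> = lfun (mw V ?\<Psi>) X"
        using insert.IH insert.prems 2 by simp
      finally show ?case .
    qed simp
  qed
  have bal: "balanced (insert w V) e" if "e \<in> Poly_Mapping.keys ((\<Prod>j\<in>V. kernel a w j) * inner)" for e
    using that
  proof (rule balanced_keys_mult[rotated -1])
    show "balanced (insert w V) e" if "e \<in> Poly_Mapping.keys inner" for e
      using balanced_inner_prod[OF fin_V that] fin_V assms
      by (auto simp: balanced_def wt_def in_keys_iff)
    have "balanced (insert w V) e" if "j \<in> V" "e \<in> Poly_Mapping.keys (kernel a w j)" for j e
      using that(2) unfolding kernel_def
      by (rule balanced_keys_mult[rotated -1]; elim balanced_keys_prod[rotated -1])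
        (use that(1) fin_V in \<open>auto elim!: balanced_keys_bino[rotated -1] simp del: power_Suc\<close>)
    then show "balanced (insert w V) e" if "e \<in> Poly_Mapping.keys (\<Prod>j\<in>V. kernel a w j)" for e
      using balanced_keys_prod[OF _ that] by blast
  qed
  have "constant_term ((\<Prod>j\<in>V. kernel a w j) * inner) =
      lfun (mw V (\<lambda>j e. poly (phi0 q e) 1)) ((\<Prod>j\<in>V. kernel a w j) * inner)"
    by (rule constant_term_balanced[OF fin_V assms bal])
  also have "\<dots> = lfun (mw V (?\<Phi> V)) ((\<Prod>j\<in>V. kernel a w j) * inner)"
    by (intro lfun_cong) (simp add: mw_def)
  finally show ?thesis by (simp add: step poly_ct_poly)
qed

end

section \<open>Antisymmetrization\<close>

text \<open>Antisymmetrization by adjacent transpositions: instead of a sum over permutations, a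
  functional that is odd under each \<open>\<tau> i\<close>. \<open>c\<close> is the scalar
  \<open>t\<close> seen inside the ring, and characteristic zero makes an odd functional vanish on
  fixed elements.\<close>

locale swaps =
  fixes v :: "nat \<Rightarrow> 'r::comm_ring_1" and \<tau> :: "nat \<Rightarrow> 'r \<Rightarrow> 'r" and c :: 'r and t :: "'a::field_char_0"
  assumes hom: "comm_ring_hom (\<tau> i)"
    and swap: "\<tau> i (v l) = v (transpose i (Suc i) l)"
    and fix_c: "\<tau> i c = c"
begin

lemmas hom_simps = comm_ring_hom.add[OF hom] comm_ring_hom.diff[OF hom] comm_ring_hom.mult[OF hom]
  comm_ring_hom.prod[OF hom] comm_ring_hom.power[OF hom] swap fix_c

definition alternating :: "nat \<Rightarrow> ('r \<Rightarrow> 'a) \<Rightarrow> bool"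
  where "alternating m B \<longleftrightarrow> (\<forall>x y. B (x + y) = B x + B y) \<and> (\<forall>x. B (c * x) = t * B x) \<and>
     (\<forall>i x. Suc i < m \<longrightarrow> B (\<tau> i x) = - B x)"

lemma alternating_add: "alternating m B \<Longrightarrow> B (x + y) = B x + B y"
  and alternating_c: "alternating m B \<Longrightarrow> B (c * x) = t * B x"
  and alternating_swap: "alternating m B \<Longrightarrow> Suc i < m \<Longrightarrow> B (\<tau> i x) = - B x"
  by (auto simp: alternating_def)

lemma alternating_diff: "alternating m B \<Longrightarrow> B (x - y) = B x - B y"
  using alternating_add[of m B "x - y" y] by simp

lemma alternating_eq_0: "alternating m B \<Longrightarrow> Suc i < m \<Longrightarrow> \<tau> i x = x \<Longrightarrow> B x = 0"
  using alternating_swap[of m B i x] by simp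

lemma alternating_mono: "alternating m B \<Longrightarrow> l \<le> m \<Longrightarrow> alternating l B"
  by (auto simp: alternating_def)

lemma alternating_mult:
  assumes "alternating m B" "\<And>i. Suc i < m \<Longrightarrow> \<tau> i y = y"
  shows "alternating m (\<lambda>x. B (y * x))"
  unfolding alternating_def
proof (intro conjI allI impI)
  show "B (y * (x + z)) = B (y * x) + B (y * z)" for x z
    by (simp add: distrib_left alternating_add[OF assms(1)])
  show "B (y * (c * x)) = t * B (y * x)" for x
    by (simp add: mult.left_commute alternating_c[OF assms(1)])
  show "B (y * \<tau> i x) = - B (y * x)" if "Suc i < m" for i x
    using alternating_swap[OF assms(1) that, of "y * x"] assms(2)[OF that] by (simp add: hom_simps)
qed

lemma prod_swap:
  assumes "Suc i < m" "\<And>l. l < m \<Longrightarrow> \<tau> i (F l) = F (transpose i (Suc i) l)"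
  shows "\<tau> i (\<Prod>l<m. F l) = (\<Prod>l<m. F l)"
proof -
  have "\<tau> i (\<Prod>l<m. F l) = (\<Prod>l<m. F (transpose i (Suc i) l))"
    using assms(2) by (simp add: hom_simps)
  also have "\<dots> = (\<Prod>l<m. F l)"
    by (rule prod.reindex_bij_witness[of _ "transpose i (Suc i)" "transpose i (Suc i)"])
      (use assms(1) in \<open>auto simp: transpose_def\<close>)
  finally show ?thesis .
qed

lemma prod_v_swap: "Suc i < m \<Longrightarrow> \<tau> i (\<Prod>l<m. v l) = (\<Prod>l<m. v l)"
  by (rule prod_swap) (auto simp: swap)

text \<open>Expand the row factor by factor. Taking the second term in any factor but the last
  produces equal powers of two neighbouring variables, which \<open>B\<close> kills; in the last
  factor a transposition returns the same statement with one variable less, times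
  \<open>t\<close>.\<close>

lemma alternating_last_row:
  "alternating (Suc M) B \<Longrightarrow>
   B (\<Prod>i<M. (v i - c * v M) * v i ^ (M - 1 - i)) = (\<Sum>r<Suc M. t ^ r) * B (\<Prod>i<M. v i ^ (M - i))"
proof (induction M arbitrary: B)
  case 0
  then show ?case by simp
next
  case (Suc M)
  note B = Suc.prems
  \<comment> \<open>Hybrid products: the factors below \<open>r\<close> are unexpanded in
    \<open>A r\<close>, those from \<open>r\<close> on are replaced by their leading monomials in
    \<open>C r\<close>.\<close>
  define A where "A r = (\<Prod>i<r. (v i - c * v (Suc M)) * v i ^ (M - i))" for r
  define C where "C r = (\<Prod>i\<in>{r..M}. v i ^ (Suc M - i))" for r
  have C_step: "C r = v r ^ (Suc M - r) * C (Suc r)" if "r \<le> M" for r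
    unfolding C_def using that by (simp add: prod.atLeast_Suc_atMost)
  have A_step: "A (Suc r) = A r * (v r - c * v (Suc M)) * v r ^ (M - r)" for r
    by (simp add: A_def mult.assoc)
  have A_fix: "\<tau> r (A r) = A r" if "r < M" for r
    unfolding A_def using that by (simp add: hom_simps transpose_def)
  have step: "B (A (Suc r) * C (Suc r)) =
      B (A r * C r) - t * B (A r * v (Suc M) * v r ^ (M - r) * C (Suc r))" if "r \<le> M" for r
  proof -
    have "v r ^ (Suc M - r) = v r * v r ^ (M - r)"
      using that by (simp add: Suc_diff_le)
    then have "A (Suc r) * C (Suc r) = A r * C r - c * (A r * v (Suc M) * v r ^ (M - r) * C (Suc r))"
      unfolding A_step C_step[OF that]
      by (simp only: left_diff_distrib right_diff_distrib mult_ac)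
    then show ?thesis by (simp only: alternating_diff[OF B] alternating_c[OF B])
  qed
  have "B (A r * C r) = B (C 0)" if "r \<le> M" for r
    using that
  proof (induction r)
    case 0
    then show ?case by (simp add: A_def)
  next
    case (Suc r)
    have "\<tau> r (C (Suc (Suc r))) = C (Suc (Suc r))"
      unfolding C_def by (simp add: hom_simps transpose_def)
    moreover have "C (Suc r) = v (Suc r) ^ (M - r) * C (Suc (Suc r))"
      using C_step[of "Suc r"] Suc.prems by simp
    ultimately have "\<tau> r (A r * v (Suc M) * v r ^ (M - r) * C (Suc r)) = A r * v (Suc M) * v r ^ (M - r) * C (Suc r)"
      using A_fix[of r] Suc.prems by (simp add: hom_simps mult_ac)
    then have "B (A r * v (Suc M) * v r ^ (M - r) * C (Suc r)) = 0"
      using Suc.prems by (intro alternating_eq_0[OF B, of r]) auto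
    then show ?case using step[of r] Suc by simp
  qed
  from this[of M] step[of M] have "B (A (Suc M)) = B (C 0) - t * B (A M * v (Suc M))"
    by (simp add: C_def)
  also have "B (A M * v (Suc M)) = - B (\<tau> M (A M * v (Suc M)))"
    using alternating_swap[OF B, of M "A M * v (Suc M)"] by simp
  also have "\<tau> M (A M * v (Suc M)) = (\<Prod>i<M. (v i - c * v M) * v i ^ (M - i)) * v M"
    unfolding A_def by (simp add: hom_simps transpose_def)
  \<comment> \<open>The product of v_0, ..., v_M is symmetric, so it can be absorbed into the
    functional before the induction hypothesis is applied.\<close>
  also have "\<dots> = (\<Prod>i<Suc M. v i) * (\<Prod>i<M. (v i - c * v M) * v i ^ (M - 1 - i))"
  proof -
    have "(\<Prod>i<M. (v i - c * v M) * v i ^ (M - i)) = (\<Prod>i<M. v i * ((v i - c * v M) * v i ^ (M - 1 - i)))"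
    proof (rule prod.cong[OF refl])
      fix i assume "i \<in> {..<M}"
      then have "M - i = Suc (M - 1 - i)" by auto
      then show "(v i - c * v M) * v i ^ (M - i) = v i * ((v i - c * v M) * v i ^ (M - 1 - i))"
        by (simp add: mult_ac)
    qed
    then show ?thesis by (simp add: prod.distrib mult_ac)
  qed
  also have "B \<dots> = (\<Sum>r<Suc M. t ^ r) * B ((\<Prod>i<Suc M. v i) * (\<Prod>i<M. v i ^ (M - i)))"
    by (rule Suc.IH, rule alternating_mult[OF alternating_mono[OF B]], simp, rule prod_v_swap)
  also have "(\<Prod>i<Suc M. v i) * (\<Prod>i<M. v i ^ (M - i)) = (\<Prod>i<Suc M. v i ^ (Suc M - i))"
  proof -
    have "(\<Prod>i<M. v i ^ (Suc M - i)) = (\<Prod>i<M. v i * v i ^ (M - i))"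
      by (rule prod.cong) (auto simp: Suc_diff_le)
    then show ?thesis by (simp add: prod.distrib mult_ac)
  qed
  also have "C 0 = (\<Prod>i<Suc M. v i ^ (Suc M - i))"
    by (simp add: C_def atLeast0AtMost lessThan_Suc_atMost)
  finally show ?case
    by (simp add: A_def sum.lessThan_Suc_shift[of _ "Suc M"] distrib_right sum_distrib_left mult.assoc
        del: prod.lessThan_Suc sum.lessThan_Suc)
qed

definition deformed_vandermonde :: "nat \<Rightarrow> 'r"
  where "deformed_vandermonde m = (\<Prod>j<m. \<Prod>i<j. v i - c * v j)"

lemma last_row_swap: "Suc i < m \<Longrightarrow> \<tau> i (\<Prod>l<m. v l - c * v m) = (\<Prod>l<m. v l - c * v m)"
  by (rule prod_swap) (auto simp: hom_simps transpose_def)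

text \<open>The row of the last variable is symmetric in the earlier ones, so the induction
  hypothesis applies to \<open>B\<close> multiplied by that row; what remains is one row against a
  staircase monomial.\<close>

lemma alternating_deformed_vandermonde:
  "alternating m B \<Longrightarrow>
   B (deformed_vandermonde m) = (\<Prod>j<m. \<Sum>r<Suc j. t ^ r) * B (\<Prod>i<m. v i ^ (m - 1 - i))"
proof (induction m arbitrary: B)
  case 0
  then show ?case by (simp add: deformed_vandermonde_def)
next
  case (Suc m)
  let ?R = "\<Prod>l<m. v l - c * v m"
  have "B (deformed_vandermonde (Suc m)) = B (?R * deformed_vandermonde m)"
    by (simp add: deformed_vandermonde_def mult.commute)
  also have "\<dots> = (\<Prod>j<m. \<Sum>r<Suc j. t ^ r) * B (?R * (\<Prod>i<m. v i ^ (m - 1 - i)))"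
    by (rule Suc.IH, rule alternating_mult[OF alternating_mono[OF Suc.prems]]) (auto intro: last_row_swap)
  also have "?R * (\<Prod>i<m. v i ^ (m - 1 - i)) = (\<Prod>i<m. (v i - c * v m) * v i ^ (m - 1 - i))"
    by (simp add: prod.distrib)
  also have "B \<dots> = (\<Sum>r<Suc m. t ^ r) * B (\<Prod>i<m. v i ^ (m - i))"
    by (rule alternating_last_row[OF Suc.prems])
  finally show ?case by (simp add: mult.assoc del: sum.lessThan_Suc)
qed

text \<open>Both values are multiples of \<open>B\<close> at the same staircase monomial, and the
  multipliers differ by the last t-number. The left side will be the enlarged block, the right side
  the block with one variable split off.\<close>

lemma alternating_deformed_vandermonde_Suc:
  assumes "alternating (Suc m) B"
  shows "B (deformed_vandermonde (Suc m)) = (\<Sum>r<Suc m. t ^ r) * B ((\<Prod>i<m. v i) * deformed_vandermonde m)"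
proof -
  have "B ((\<Prod>i<m. v i) * deformed_vandermonde m) =
      (\<Prod>j<m. \<Sum>r<Suc j. t ^ r) * B ((\<Prod>i<m. v i) * (\<Prod>i<m. v i ^ (m - 1 - i)))"
    by (rule alternating_deformed_vandermonde, rule alternating_mult[OF alternating_mono[OF assms]],
      simp, rule prod_v_swap)
  also have "(\<Prod>i<m. v i) * (\<Prod>i<m. v i ^ (m - 1 - i)) = (\<Prod>i<m. v i ^ (m - i))"
    unfolding prod.distrib[symmetric] by (rule prod.cong) (auto simp: Suc_diff_Suc simp flip: power_Suc)
  finally show ?thesis
    using alternating_deformed_vandermonde[OF assms] by (simp add: mult_ac)
qed

end

section \<open>Nonvanishing of the constant term\<close>

definition cmap :: "('a::comm_ring_1 \<Rightarrow> 'b::comm_ring_1) \<Rightarrow> 'a laurent \<Rightarrow> 'b laurent"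
  where "cmap h = lext (\<lambda>c. lconst (h c)) (\<lambda>e. Poly_Mapping.single e 1)"

context
  fixes h :: "'a::comm_ring_1 \<Rightarrow> 'b::comm_ring_1"
  assumes h: "comm_ring_hom h"
begin

lemma lconst_hom: "comm_ring_hom (\<lambda>c. lconst (h c))"
  using h comm_ring_hom_lconst[where 'a = 'b] by (simp add: comm_ring_hom_def)

lemma cmap_single: "cmap h (Poly_Mapping.single e c) = Poly_Mapping.single e (h c)"
  using lext_single[of "\<lambda>c. lconst (h c)" "\<lambda>e. Poly_Mapping.single e 1" e c] comm_ring_hom.zero[OF lconst_hom]
  by (simp add: cmap_def) (simp add: lconst_def mult_single)

lemma comm_ring_hom_cmap: "comm_ring_hom (cmap h)"
  unfolding cmap_def by (rule comm_ring_hom_lext[OF lconst_hom]) (auto simp: mult_single)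

lemma cmap_bino: "cmap h (bino c i j) = bino (h c) i j"
  by (simp add: bino_def lvar_mult_inv lconst_def mult_single comm_ring_hom.diff[OF comm_ring_hom_cmap]
      comm_ring_hom.one[OF comm_ring_hom_cmap] cmap_single)

lemma cmap_inner_prod: "cmap h (inner_prod q k blk V) = inner_prod (h q) k blk V"
  by (simp add: inner_prod_def pairf_bino comm_ring_hom.prod[OF comm_ring_hom_cmap] case_prod_unfold
      comm_ring_hom.mult[OF comm_ring_hom_cmap] cmap_bino comm_ring_hom.power[OF h] comm_ring_hom.mult[OF h])

lemma constant_term_cmap: "constant_term (cmap h f) = h (constant_term f)"
proof (induction f rule: laurent_induct)
  case (single e c)
  then show ?case
    by (simp add: cmap_single constant_term_def lookup_single when_def comm_ring_hom.zero[OF h])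
qed (simp add: comm_ring_hom.add[OF comm_ring_hom_cmap] comm_ring_hom.add[OF h] constant_term_add)

lemma constant_term_inner_prod_hom:
  "constant_term (inner_prod (h q) k blk V) = h (constant_term (inner_prod q k blk V))"
  by (simp add: cmap_inner_prod constant_term_cmap flip: cmap_inner_prod)

end

definition conj_laurent :: "'a::comm_ring_1 laurent \<Rightarrow> 'a laurent"
  where "conj_laurent = lext lconst (\<lambda>e. Poly_Mapping.single (- e) 1)"

lemma conj_laurent_single: "conj_laurent (Poly_Mapping.single e c) = Poly_Mapping.single (- e) c"
  by (simp add: conj_laurent_def lext_single comm_ring_hom.zero[OF comm_ring_hom_lconst] lconst_def mult_single)

lemma comm_ring_hom_conj: "comm_ring_hom conj_laurent"
  unfolding conj_laurent_def by (rule comm_ring_hom_lext[OF comm_ring_hom_lconst]) (auto simp: mult_single)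

lemma conj_laurent_bino: "conj_laurent (bino c i j) = bino c j i"
proof -
  have "- zratio i j = zratio j i" by (intro poly_mapping_eqI) (simp add: lookup_zratio)
  then show ?thesis
    by (simp add: bino_def lvar_mult_inv lconst_def mult_single comm_ring_hom.diff[OF comm_ring_hom_conj]
        comm_ring_hom.one[OF comm_ring_hom_conj] conj_laurent_single)
qed

text \<open>\<open>conj_laurent\<close> inverts the variables, so this is the bilinear form in which
  monomials are orthonormal; f = g gives a sum of squares.\<close>

lemma constant_term_conj: "constant_term (f * conj_laurent g) = lfun (Poly_Mapping.lookup g) f"
proof (induction f rule: laurent_induct)
  case (single e c)
  show ?case
  proof (induction g rule: laurent_induct)
    case (single d b)
    then show ?case
      by (auto simp: conj_laurent_single mult_single constant_term_def lext_single lookup_single when_def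
          eq_neg_iff_add_eq_0)
  next
    case (add g g')
    then show ?case
      by (simp add: comm_ring_hom.add[OF comm_ring_hom_conj] distrib_left constant_term_add lext_single lookup_add)
  qed
qed (simp add: distrib_right constant_term_add lfun_add)

lemma constant_term_inner_prod_1:
  fixes V :: "nat set"
  assumes "finite V"
  shows "constant_term (inner_prod (1::rat) k blk V) \<noteq> 0"
proof -
  \<comment> \<open>At q = 1 a pair factor is (1 - z_i / z_j)^l (1 - z_j / z_i)^l, whose halves are
    conjugate to each other.\<close>
  define P :: "rat laurent" where "P = (\<Prod>(i, j)\<in>ordered_pairs V. bino 1 i j ^ lam k blk i j)"
  have "inner_prod 1 k blk V = P * conj_laurent P"
    by (simp add: P_def inner_prod_def pairf_bino comm_ring_hom.prod[OF comm_ring_hom_conj] case_prod_unfold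
        comm_ring_hom.power[OF comm_ring_hom_conj] conj_laurent_bino prod.distrib)
  then have "constant_term (inner_prod 1 k blk V) = (\<Sum>e\<in>Poly_Mapping.keys P. Poly_Mapping.lookup P e ^ 2)"
    by (simp add: constant_term_conj lext_def power2_eq_square)
  moreover have "P \<noteq> 0"
  proof
    assume P: "P = 0"
    \<comment> \<open>Evaluation at the distinct points z_j = 2^j, where no binomial 1 - z_i / z_j
      with i < j vanishes.\<close>
    let ?\<chi> = "\<lambda>e. \<Prod>j\<in>V. (2 ^ j :: rat) powi Poly_Mapping.lookup e j"
    let ?ev = "lfun ?\<chi>"
    have hom: "comm_ring_hom ?ev"
      by (rule comm_ring_hom_lext) (auto simp: comm_ring_hom_def lookup_add power_int_add prod.distrib)
    have "?ev (bino 1 i j) \<noteq> 0" if "i \<in> V" "j \<in> V" "i < j" for i j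
    proof -
      have "?\<chi> (zratio i j) = (\<Prod>l\<in>V. if l = i then 2 ^ i else 1) * (\<Prod>l\<in>V. if l = j then inverse (2 ^ j) else 1)"
        unfolding prod.distrib[symmetric] using that
        by (intro prod.cong) (auto simp: lookup_zratio power_int_minus)
      then have "?ev (bino 1 i j) = 1 - 2 ^ i * inverse (2 ^ j)"
        using assms that comm_ring_hom.one[OF hom]
        by (simp add: bino_def lvar_mult_inv lconst_def mult_single comm_ring_hom.diff[OF hom] lext_single)
      moreover have "(2::rat) ^ i * inverse (2 ^ j) < 1" using that by (simp add: field_simps)
      ultimately show ?thesis by linarith
    qed
    then have "?ev P \<noteq> 0"
      using assms by (simp add: P_def comm_ring_hom.prod[OF hom] case_prod_unfold comm_ring_hom.power[OF hom])
        (auto simp: ordered_pairs_def)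
    then show False using P by simp
  qed
  then have "(\<Sum>e\<in>Poly_Mapping.keys P. Poly_Mapping.lookup P e ^ 2) > 0"
    by (intro sum_pos) (auto simp: in_keys_iff)
  ultimately show ?thesis by simp
qed

lemma comm_ring_hom_to_fract: "comm_ring_hom (to_fract :: rat poly \<Rightarrow> rat poly fract)"
  by unfold_locales auto

lemma q_indet_to_fract: "q_indet = to_fract [:0, 1:]"
  by (simp add: q_indet_def to_fract_def)

text \<open>An element of the fraction field cannot simply be specialized, so the constant term is
  computed over \<open>rat poly\<close>, which embeds into the fractions and also maps to
  \<open>rat\<close> by q = 1.\<close>

lemma constant_term_inner_prod_q_indet:
  assumes "finite V"
  shows "constant_term (inner_prod q_indet k blk V) \<noteq> 0"
proof
  let ?c = "constant_term (inner_prod ([:0, 1:] :: rat poly) k blk V)"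
  assume "constant_term (inner_prod q_indet k blk V) = 0"
  then have "to_fract ?c = 0"
    by (simp add: q_indet_to_fract constant_term_inner_prod_hom[OF comm_ring_hom_to_fract])
  then have "poly ?c 1 = 0" by simp
  moreover have "comm_ring_hom (\<lambda>p :: rat poly. poly p 1)" by unfold_locales auto
  from constant_term_inner_prod_hom[OF this, of "[:0, 1:]" k blk V]
  have "poly ?c 1 = constant_term (inner_prod 1 k blk V)" by simp
  ultimately show False using constant_term_inner_prod_1[OF assms] by simp
qed

lemma generic_q_indet: "generic_q q_indet"
proof
  show "q_indet \<noteq> 0" by (simp add: q_indet_to_fract)
  fix m :: nat assume "m \<ge> 1"
  have "q_indet ^ m = to_fract (monom 1 m)"
    by (simp add: q_indet_to_fract monom_altdef flip: comm_ring_hom.power[OF comm_ring_hom_to_fract])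
  moreover have "monom (1::rat) m \<noteq> 1"
    using \<open>m \<ge> 1\<close> by (auto simp: poly_eq_iff coeff_1 intro!: exI[of _ m])
  ultimately show "q_indet ^ m \<noteq> 1"
    by (metis to_fract_1 to_fract_eq_iff)
qed

section \<open>The blocks\<close>

text \<open>Pulling z_i and its inverse out of the two brackets leaves (1 - q^(k+1) z_j / z_i) (1 -
  q^k z_i / z_j), exactly the binomials by which a pair of length k + 1 exceeds one of length
  k.\<close>

lemma D_integrand_eq_inner_prod:
  fixes q :: "'a::comm_ring_1"
  assumes blk: "\<And>i \<alpha>. i \<in> {1..(\<Sum>l\<le>p. m l)} \<Longrightarrow> \<alpha> \<le> p \<Longrightarrow> i \<in> Jblock m \<alpha> \<longleftrightarrow> blk i = \<alpha>"
    and le: "\<And>i. i \<in> {1..(\<Sum>l\<le>p. m l)} \<Longrightarrow> blk i \<le> p"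
  shows "D_integrand p m k q = inner_prod q k blk {1..(\<Sum>l\<le>p. m l)}"
proof -
  let ?W = "{1..(\<Sum>l\<le>p. m l)}"
  define g :: "nat \<Rightarrow> nat \<Rightarrow> 'a laurent" where
    "g i j = (lvar i - lconst (q ^ (k + 1)) * lvar j) * (lvar_inv i - lconst (q ^ k) * lvar_inv j)" for i j
  have g: "g i j = bino (q ^ k) i j * bino (q ^ Suc k) j i" for i j
  proof -
    have 1: "lvar i * (1 - lconst (q ^ Suc k) * (lvar j * lvar_inv i)) = lvar i - lconst (q ^ (k + 1)) * lvar j * (lvar i * lvar_inv i)"
      unfolding right_diff_distrib by (simp add: mult_ac)
    have 2: "lvar_inv i * (1 - lconst (q ^ k) * (lvar i * lvar_inv j)) = lvar_inv i - lconst (q ^ k) * lvar_inv j * (lvar i * lvar_inv i)"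
      unfolding right_diff_distrib by (simp add: mult_ac)
    have "g i j = (lvar i * (1 - lconst (q ^ Suc k) * (lvar j * lvar_inv i))) *
        (lvar_inv i * (1 - lconst (q ^ k) * (lvar i * lvar_inv j)))"
      by (simp only: 1 2 g_def lvar_mult_lvar_inv mult_1_right)
    also have "\<dots> = (lvar i * lvar_inv i) * (bino (q ^ k) i j * bino (q ^ Suc k) j i)"
      unfolding bino_def by (simp only: mult_ac)
    finally show ?thesis by (simp only: lvar_mult_lvar_inv mult_1_left)
  qed
  have sub: "Jblock m \<alpha> \<subseteq> ?W" if "\<alpha> \<le> p" for \<alpha>
  proof -
    have "(\<Sum>j\<le>\<alpha>. m j) \<le> (\<Sum>j\<le>p. m j)" using that by (intro sum_mono2) auto
    then show ?thesis by (auto simp: Jblock_def)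
  qed
  have pair: "(i, j) \<in> ordered_pairs (Jblock m \<alpha>) \<longleftrightarrow> (i, j) \<in> ordered_pairs ?W \<and> blk i = \<alpha> \<and> blk j = \<alpha>"
    if "\<alpha> \<le> p" for i j \<alpha>
    using blk[OF _ that] sub[OF that] by (auto simp: ordered_pairs_def)
  have "(\<Prod>\<alpha>=1..p. \<Prod>(i, j)\<in>{(i, j). i \<in> Jblock m \<alpha> \<and> j \<in> Jblock m \<alpha> \<and> i < j}. g i j) =
      (\<Prod>\<alpha>=1..p. \<Prod>(i, j)\<in>ordered_pairs (Jblock m \<alpha>). g i j)"
    by (simp add: ordered_pairs_def)
  also have "\<dots> = (\<Prod>(i, j)\<in>(\<Union>\<alpha>\<in>{1..p}. ordered_pairs (Jblock m \<alpha>)). g i j)"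
  proof (rule prod.UNION_disjoint[symmetric])
    show "\<forall>\<alpha>\<in>{1..p}. finite (ordered_pairs (Jblock m \<alpha>))" by (auto simp: Jblock_def)
    show "\<forall>\<alpha>\<in>{1..p}. \<forall>\<beta>\<in>{1..p}. \<alpha> \<noteq> \<beta> \<longrightarrow> ordered_pairs (Jblock m \<alpha>) \<inter> ordered_pairs (Jblock m \<beta>) = {}"
      using pair by auto
  qed simp
  also have "(\<Union>\<alpha>\<in>{1..p}. ordered_pairs (Jblock m \<alpha>)) =
      {x \<in> ordered_pairs ?W. case x of (i, j) \<Rightarrow> blk i = blk j \<and> blk i \<ge> 1}"
  proof -
    have "x \<in> (\<Union>\<alpha>\<in>{1..p}. ordered_pairs (Jblock m \<alpha>)) \<longleftrightarrow>
        x \<in> ordered_pairs ?W \<and> blk (fst x) = blk (snd x) \<and> blk (fst x) \<ge> 1" for x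
    proof -
      have "blk (fst x) \<le> p" if "x \<in> ordered_pairs ?W"
        using le[of "fst x"] that by (auto simp: ordered_pairs_def)
      then show ?thesis using pair[of _ "fst x" "snd x"] by fastforce
    qed
    then show ?thesis by (intro set_eqI) (simp only: mem_Collect_eq case_prod_unfold)
  qed
  also have "(\<Prod>(i, j)\<in>\<dots>. g i j) =
      (\<Prod>(i, j)\<in>ordered_pairs ?W. if blk i = blk j \<and> blk i \<ge> 1 then g i j else 1)"
    by (rule prod.mono_neutral_cong_left) (auto split: if_splits)
  finally have blocks: "(\<Prod>\<alpha>=1..p. \<Prod>(i, j)\<in>{(i, j). i \<in> Jblock m \<alpha> \<and> j \<in> Jblock m \<alpha> \<and> i < j}. g i j) =
      (\<Prod>(i, j)\<in>ordered_pairs ?W. if blk i = blk j \<and> blk i \<ge> 1 then g i j else 1)" .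
  have pairs: "{(i, j). 1 \<le> i \<and> i < j \<and> j \<le> (\<Sum>l\<le>p. m l)} = ordered_pairs ?W"
    by (auto simp: ordered_pairs_def)
  have "D_integrand p m k q = (\<Prod>(i, j)\<in>ordered_pairs ?W. (if blk i = blk j \<and> blk i \<ge> 1 then g i j else 1) * pairf q k i j)"
    using blocks unfolding D_integrand_def g_def[symmetric] pairs pairf_def[symmetric]
    by (simp add: case_prod_unfold prod.distrib)
  also have "\<dots> = inner_prod q k blk ?W"
    unfolding inner_prod_def
    by (rule prod.cong) (auto simp: lam_def pairf_bino g mult_ac simp del: power_Suc)
  finally show ?thesis .
qed

definition block_of :: "(nat \<Rightarrow> nat) \<Rightarrow> nat \<Rightarrow> nat"
  where "block_of m i = (LEAST \<alpha>. i \<le> (\<Sum>j\<le>\<alpha>. m j))"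

lemma block_of_le: "i \<le> (\<Sum>j\<le>p. m j) \<Longrightarrow> block_of m i \<le> p"
  unfolding block_of_def by (rule Least_le)

lemma Jblock_iff_block_of:
  assumes "1 \<le> i" "i \<le> (\<Sum>j\<le>p. m j)"
  shows "i \<in> Jblock m \<alpha> \<longleftrightarrow> block_of m i = \<alpha>"
proof
  assume i: "i \<in> Jblock m \<alpha>"
  show "block_of m i = \<alpha>"
    unfolding block_of_def
  proof (rule Least_equality)
    show "i \<le> (\<Sum>j\<le>\<alpha>. m j)" using i by (simp add: Jblock_def)
    show "\<alpha> \<le> \<beta>" if "i \<le> (\<Sum>j\<le>\<beta>. m j)" for \<beta>
    proof (rule ccontr)
      assume "\<not> \<alpha> \<le> \<beta>"
      then have "(\<Sum>j\<le>\<beta>. m j) \<le> (\<Sum>j<\<alpha>. m j)" by (intro sum_mono2) auto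
      then show False using i that by (simp add: Jblock_def)
    qed
  qed
next
  assume \<alpha>: "block_of m i = \<alpha>"
  have "i \<le> (\<Sum>j\<le>\<alpha>. m j)"
    unfolding \<alpha>[symmetric] block_of_def by (rule LeastI) (rule assms(2))
  moreover have "(\<Sum>j<\<alpha>. m j) < i"
  proof (cases \<alpha>)
    case 0
    then show ?thesis using assms(1) by simp
  next
    case (Suc \<beta>)
    then have "\<not> i \<le> (\<Sum>j\<le>\<beta>. m j)" using \<alpha> unfolding block_of_def by (intro not_less_Least) simp
    then show ?thesis by (simp add: Suc lessThan_Suc_atMost)
  qed
  ultimately show "i \<in> Jblock m \<alpha>" by (simp add: Jblock_def)
qed

lemma block_of_mono:
  assumes "i \<le> j" "j \<le> (\<Sum>l\<le>p. m l)"
  shows "block_of m i \<le> block_of m j"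
proof -
  have "j \<le> (\<Sum>l\<le>block_of m j. m l)"
    unfolding block_of_def by (rule LeastI) (rule assms(2))
  then show ?thesis using assms(1) by (intro block_of_le) simp
qed

section \<open>Quotients of q-factorials\<close>

lemma qfactorial_add: "qfactorial q (k + L) = qfactorial q k * (\<Prod>h=1..L. qnumber q (k + h))"
  by (induction L) (simp_all add: qfactorial_def mult.assoc)

context generic_q
begin

lemma qnumber_nz: "m \<ge> 1 \<Longrightarrow> qnumber q m \<noteq> 0"
  using q_root[of m] q_root[of 1] by (auto simp: qnumber_def)

lemma qfactorial_nz: "qfactorial q m \<noteq> 0"
  by (auto simp: qfactorial_def qnumber_nz)

lemma prod_ratio_qfactorial:
  "(\<Prod>h=1..L. 1 - q ^ (k + h)) / (\<Prod>h=1..L. 1 - q ^ h) = qfactorial q (k + L) / (qfactorial q k * qfactorial q L)"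
proof -
  have "1 - q \<noteq> 0" using q_root[of 1] by simp
  then have "(\<Prod>h=1..L. 1 - q ^ (k + h)) / (\<Prod>h=1..L. 1 - q ^ h) = (\<Prod>h=1..L. qnumber q (k + h) / qnumber q h)"
    by (simp add: qnumber_def flip: prod_dividef)
  then show ?thesis
    by (simp add: qfactorial_add prod_dividef qfactorial_nz) (simp add: qfactorial_def)
qed

end

section \<open>Exchanging two variables\<close>

definition swap_exp :: "nat \<Rightarrow> nat \<Rightarrow> (nat \<Rightarrow>\<^sub>0 int) \<Rightarrow> (nat \<Rightarrow>\<^sub>0 int)"
  where "swap_exp x y = Poly_Mapping.map_key (transpose x y)"

lemma lookup_swap_exp: "Poly_Mapping.lookup (swap_exp x y e) l = Poly_Mapping.lookup e (transpose x y l)"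
  by (simp add: swap_exp_def map_key.rep_eq)

lemma swap_exp_eq_0_iff: "swap_exp x y e = 0 \<longleftrightarrow> e = 0"
  by (metis lookup_swap_exp lookup_zero poly_mapping_eqI transpose_involutory)

definition lswap :: "nat \<Rightarrow> nat \<Rightarrow> 'a::comm_ring_1 laurent \<Rightarrow> 'a laurent"
  where "lswap x y = lext lconst (\<lambda>e. Poly_Mapping.single (swap_exp x y e) 1)"

lemma lswap_single: "lswap x y (Poly_Mapping.single e c) = Poly_Mapping.single (swap_exp x y e) c"
  by (simp add: lswap_def lext_single comm_ring_hom.zero[OF comm_ring_hom_lconst] lconst_def mult_single)

lemma comm_ring_hom_lswap: "comm_ring_hom (lswap x y :: 'a::comm_ring_1 laurent \<Rightarrow> 'a laurent)"
  unfolding lswap_def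
proof (rule comm_ring_hom_lext[OF comm_ring_hom_lconst])
  have "swap_exp x y (d + e) = swap_exp x y d + swap_exp x y e" for d e
    by (intro poly_mapping_eqI) (simp add: lookup_swap_exp lookup_add)
  then show "Poly_Mapping.single (swap_exp x y (d + e)) 1 =
      Poly_Mapping.single (swap_exp x y d) (1::'a) * Poly_Mapping.single (swap_exp x y e) 1" for d e
    by (simp add: mult_single)
  have "swap_exp x y 0 = 0" by (simp add: swap_exp_eq_0_iff)
  then show "Poly_Mapping.single (swap_exp x y 0) (1::'a) = 1" by simp
qed

lemma swap_exp_single: "swap_exp x y (Poly_Mapping.single l c) = Poly_Mapping.single (transpose x y l) c"
  by (intro poly_mapping_eqI) (auto simp: lookup_swap_exp lookup_single when_def)

lemma lswap_lvar: "lswap x y (lvar l) = lvar (transpose x y l)"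
  and lswap_lvar_inv: "lswap x y (lvar_inv l) = lvar_inv (transpose x y l)"
  by (simp_all add: lvar_def lvar_inv_def lswap_single swap_exp_single)

lemma lswap_lconst: "lswap x y (lconst c) = lconst c"
proof -
  have "swap_exp x y 0 = 0" by (simp add: swap_exp_eq_0_iff)
  then show ?thesis by (simp add: lconst_def lswap_single)
qed

lemmas lswap_simps = comm_ring_hom.add[OF comm_ring_hom_lswap] comm_ring_hom.diff[OF comm_ring_hom_lswap]
  comm_ring_hom.mult[OF comm_ring_hom_lswap] comm_ring_hom.prod[OF comm_ring_hom_lswap]
  comm_ring_hom.one[OF comm_ring_hom_lswap] lswap_lvar lswap_lvar_inv lswap_lconst

lemma lswap_bino: "lswap x y (bino c i j) = bino c (transpose x y i) (transpose x y j)"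
  by (simp add: bino_def lswap_simps)

lemma constant_term_lswap: "constant_term (lswap x y f) = constant_term f"
proof (induction f rule: laurent_induct)
  case (single e c)
  then show ?case
    by (auto simp: lswap_single constant_term_def lookup_single when_def swap_exp_eq_0_iff)
qed (simp add: comm_ring_hom.add[OF comm_ring_hom_lswap] constant_term_add)

lemma prod_ordered_pairs_tail:
  fixes F :: "nat \<Rightarrow> nat \<Rightarrow> 'r::comm_monoid_mult"
  shows "(\<Prod>(i, j)\<in>ordered_pairs {1..s + m}. if s < i \<and> s < j then F i j else 1) =
    (\<Prod>b<m. \<Prod>a<b. F (s + 1 + a) (s + 1 + b))"
proof -
  have "(\<Prod>(i, j)\<in>ordered_pairs {1..s + m}. if s < i \<and> s < j then F i j else 1) =
      (\<Prod>(i, j)\<in>ordered_pairs {s + 1..s + m}. F i j)"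
    using finite_ordered_pairs[of "{1..s + m}"]
    by (intro prod.mono_neutral_cong_right) (auto simp: ordered_pairs_def split: if_splits)
  also have "\<dots> = (\<Prod>(b, a)\<in>(SIGMA b:{..<m}. {..<b}). F (s + 1 + a) (s + 1 + b))"
    by (rule prod.reindex_bij_witness[of _ "\<lambda>(b, a). (s + 1 + a, s + 1 + b)" "\<lambda>(i, j). (j - s - 1, i - s - 1)"])
      (auto simp: ordered_pairs_def)
  also have "\<dots> = (\<Prod>b<m. \<Prod>a<b. F (s + 1 + a) (s + 1 + b))"
    by (rule prod.Sigma[symmetric]) auto
  finally show ?thesis .
qed

lemma prod_ordered_pairs_insert:
  fixes F :: "nat \<Rightarrow> nat \<Rightarrow> 'r::comm_monoid_mult"
  shows "(\<Prod>(i, j)\<in>ordered_pairs {1..Suc N}. F i j) =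
    (\<Prod>(i, j)\<in>ordered_pairs {1..N}. F i j) * (\<Prod>j\<in>{1..N}. F j (Suc N))"
proof -
  have eq: "ordered_pairs {1..Suc N} = ordered_pairs {1..N} \<union> (\<lambda>j. (j, Suc N)) ` {1..N}"
    by (auto simp: ordered_pairs_def le_Suc_eq)
  have "(\<Prod>(i, j)\<in>ordered_pairs {1..Suc N}. F i j) =
      (\<Prod>(i, j)\<in>ordered_pairs {1..N}. F i j) * (\<Prod>(i, j)\<in>(\<lambda>j. (j, Suc N)) ` {1..N}. F i j)"
    unfolding eq using finite_ordered_pairs[of "{1..N}"] by (intro prod.union_disjoint) (auto simp: ordered_pairs_def)
  also have "(\<Prod>(i, j)\<in>(\<lambda>j. (j, Suc N)) ` {1..N}. F i j) = (\<Prod>j\<in>{1..N}. F j (Suc N))"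
    by (subst prod.reindex) (auto simp: inj_on_def)
  finally show ?thesis .
qed

section \<open>Splitting pair factors into an odd part and a linear factor\<close>

definition sym_pair :: "'a::comm_ring_1 \<Rightarrow> nat \<Rightarrow> nat \<Rightarrow> nat \<Rightarrow> 'a laurent"
  where "sym_pair q k i j = (\<Prod>m<k. bino (q ^ Suc m) i j) * (\<Prod>m<k. bino (q ^ Suc m) j i)"

text \<open>The last bracket equals 1 / z_i - 1 / z_j, the only odd factor.\<close>

definition anti_pair :: "'a::comm_ring_1 \<Rightarrow> nat \<Rightarrow> nat \<Rightarrow> nat \<Rightarrow> 'a laurent"
  where "anti_pair q k i j = sym_pair q k i j * (lvar_inv i * lvar_inv j * (lvar j - lvar i))"

lemma anti_pair_swap:
  fixes q :: "'a::comm_ring_1"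
  shows "anti_pair q k j i = - anti_pair q k i j"
proof -
  have "sym_pair q k j i = sym_pair q k i j"
    unfolding sym_pair_def by (rule mult.commute)
  moreover have "lvar_inv j * lvar_inv i * (lvar i - lvar j :: 'a laurent) = - (lvar_inv i * lvar_inv j * (lvar j - lvar i))"
    by (simp add: algebra_simps)
  ultimately show ?thesis unfolding anti_pair_def by (simp only: mult_minus_right)
qed

lemma bino_eq_lvar_inv_mult: "bino c i j = lvar_inv j * (lvar j - lconst c * lvar i)"
proof -
  have "lvar_inv j * (lvar j - lconst c * lvar i) = lvar j * lvar_inv j - lconst c * (lvar i * lvar_inv j)"
    unfolding right_diff_distrib by (simp only: mult_ac)
  then show ?thesis by (simp only: bino_def lvar_mult_lvar_inv)
qed

lemma lconst_1: "lconst 1 = 1"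
  by (rule comm_ring_hom.one[OF comm_ring_hom_lconst])

text \<open>The pair of length k + 1 without its last binomial: z_i alone takes the place of the
  linear factor z_i - q^(k+1) z_j. With the extra variable as \<open>j\<close> this is the kernel,
  which explains a = k and b = k + 1 on the last block.\<close>

lemma prod_bino_Suc_anti_pair:
  fixes q :: "'a::comm_ring_1"
  shows "(\<Prod>m<Suc k. bino (q ^ m) i j) * (\<Prod>m<k. bino (q ^ Suc m) j i) = anti_pair q k i j * lvar i"
proof -
  have "(\<Prod>m<Suc k. bino (q ^ m) i j) = bino 1 i j * (\<Prod>m<k. bino (q ^ Suc m) i j)"
    by (subst prod.lessThan_Suc_shift) simp
  moreover have "bino 1 i j = lvar_inv j * (lvar j - lvar i :: 'a laurent)"
    by (simp add: bino_eq_lvar_inv_mult lconst_1)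
  ultimately have eq: "(\<Prod>m<Suc k. bino (q ^ m) i j) * (\<Prod>m<k. bino (q ^ Suc m) j i) =
      sym_pair q k i j * (lvar_inv j * (lvar j - lvar i)) * 1"
    unfolding sym_pair_def by (simp only: mult_ac mult_1_right mult_1_left)
  note eq
  also have "(1 :: 'a laurent) = lvar i * lvar_inv i" by (rule lvar_mult_lvar_inv[symmetric])
  finally show ?thesis unfolding anti_pair_def by (simp only: mult_ac)
qed

lemma pairf_Suc_anti_pair:
  "pairf q (Suc k) i j = anti_pair q k i j * (lvar i - lconst (q ^ Suc k) * lvar j)"
proof -
  have "pairf q (Suc k) i j =
      ((\<Prod>m<Suc k. bino (q ^ m) i j) * (\<Prod>m<k. bino (q ^ Suc m) j i)) * bino (q ^ Suc k) j i"
    unfolding pairf_bino prod.lessThan_Suc[of "\<lambda>m. bino (q ^ Suc m) j i"] by (simp only: mult_ac)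
  also have "\<dots> = anti_pair q k i j * (lvar i - lconst (q ^ Suc k) * lvar j) * (lvar i * lvar_inv i)"
    unfolding prod_bino_Suc_anti_pair unfolding bino_eq_lvar_inv_mult[of "q ^ Suc k" j i] by (simp only: mult_ac)
  finally show ?thesis by (simp only: lvar_mult_lvar_inv mult_1_right)
qed

text \<open>An adjacent transposition permutes the ordered pairs other than the one it reverses, so
  equivariance plus oddness at that single pair suffices.\<close>

lemma lswap_prod_pairs:
  fixes Y :: "nat \<Rightarrow> nat \<Rightarrow> 'a::comm_ring_1 laurent"
  assumes "finite W" "x \<in> W" "Suc x \<in> W"
    and "\<And>i j. i \<in> W \<Longrightarrow> j \<in> W \<Longrightarrow> lswap x (Suc x) (Y i j) = Y (transpose x (Suc x) i) (transpose x (Suc x) j)"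
    and "Y (Suc x) x = - Y x (Suc x)"
  shows "lswap x (Suc x) (\<Prod>(i, j)\<in>ordered_pairs W. Y i j) = - (\<Prod>(i, j)\<in>ordered_pairs W. Y i j)"
proof -
  let ?\<sigma> = "transpose x (Suc x)"
  let ?O = "ordered_pairs W - {(x, Suc x)}"
  have split: "(\<Prod>(i, j)\<in>ordered_pairs W. G i j) = G x (Suc x) * (\<Prod>(i, j)\<in>?O. G i j)"
    for G :: "nat \<Rightarrow> nat \<Rightarrow> 'a laurent"
    using assms(2,3) finite_ordered_pairs[OF assms(1)] by (subst prod.remove[of _ "(x, Suc x)"]) (auto simp: ordered_pairs_def)
  have "lswap x (Suc x) (\<Prod>(i, j)\<in>ordered_pairs W. Y i j) = (\<Prod>(i, j)\<in>ordered_pairs W. Y (?\<sigma> i) (?\<sigma> j))"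
    using assms(4) by (auto simp: lswap_simps ordered_pairs_def case_prod_unfold intro!: prod.cong)
  also have "\<dots> = - Y x (Suc x) * (\<Prod>(i, j)\<in>?O. Y (?\<sigma> i) (?\<sigma> j))"
    unfolding split by (simp add: assms(5))
  also have "(\<Prod>(i, j)\<in>?O. Y (?\<sigma> i) (?\<sigma> j)) = (\<Prod>(i, j)\<in>?O. Y i j)"
    by (rule prod.reindex_bij_witness[of _ "map_prod ?\<sigma> ?\<sigma>" "map_prod ?\<sigma> ?\<sigma>"])
      (use assms(2,3) in \<open>auto simp: ordered_pairs_def transpose_def split: if_splits\<close>)
  finally show ?thesis by (simp add: split)
qed

text \<open>The enlarged integrand and the integrand with kernel share the odd product
  \<open>Yprod\<close>; their cofactors are the two arguments compared in
  \<open>alternating_deformed_vandermonde_Suc\<close>.\<close>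

lemma constant_term_inner_prod_Suc:
  fixes q :: "'a::field_char_0"
  assumes db: "dyson_blocks q {1..s + m} k p blk"
    and blk: "\<And>i. i \<in> {1..Suc (s + m)} \<Longrightarrow> blk i = p \<longleftrightarrow> s < i"
  shows "constant_term (inner_prod q k blk {1..Suc (s + m)}) =
    (\<Sum>r<Suc m. (q ^ Suc k) ^ r) * poly (dyson_blocks.ct_poly q {1..s + m} k p blk) (q ^ k)"
proof -
  interpret dyson_blocks q "{1..s + m}" k p blk by (rule db)
  let ?w = "Suc (s + m)"
  let ?W = "{1..?w}"
  let ?t = "lconst (q ^ Suc k)"
  let ?v = "\<lambda>i. lvar (s + 1 + i) :: 'a laurent"
  interpret swaps ?v "\<lambda>i. lswap (s + 1 + i) (Suc (s + 1 + i))" ?t "q ^ Suc k"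
    by unfold_locales (auto simp: comm_ring_hom.add[OF comm_ring_hom_lswap] comm_ring_hom.mult[OF comm_ring_hom_lswap]
        lswap_simps transpose_def)
  \<comment> \<open>Only pairs inside the last block are split. A swap within that block permutes
    the other pairs and changes neither their order nor their length.\<close>
  define Y where "Y i j = (if s < i \<and> s < j then anti_pair q k i j else pairf q (lam k blk i j) i j)" for i j
  define Yprod where "Yprod = (\<Prod>(i, j)\<in>ordered_pairs ?W. Y i j)"
  have lam_p: "lam k blk i j = Suc k" if "i \<in> ?W" "j \<in> ?W" "s < i" "s < j" for i j
  proof -
    have "blk i = p" "blk j = p" using that blk by blast+
    then show ?thesis using p_ge by (simp add: lam_def)
  qed
  have full: "inner_prod q k blk ?W = Yprod * deformed_vandermonde (Suc m)"
  proof -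
    have "inner_prod q k blk ?W = (\<Prod>(i, j)\<in>ordered_pairs ?W. Y i j * (if s < i \<and> s < j then lvar i - ?t * lvar j else 1))"
      unfolding inner_prod_def
      by (rule prod.cong) (auto simp: Y_def ordered_pairs_def lam_p pairf_Suc_anti_pair)
    also have "\<dots> = Yprod * (\<Prod>(i, j)\<in>ordered_pairs {1..s + Suc m}. if s < i \<and> s < j then lvar i - ?t * lvar j else 1)"
      by (simp add: Yprod_def prod.distrib case_prod_unfold)
    also have "\<dots> = Yprod * deformed_vandermonde (Suc m)"
      unfolding prod_ordered_pairs_tail deformed_vandermonde_def ..
    finally show ?thesis .
  qed
  have part: "(\<Prod>j\<in>{1..s + m}. kernel k ?w j) * inner = Yprod * ((\<Prod>i<m. ?v i) * deformed_vandermonde m)"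
  proof -
    have kern: "kernel k ?w j = Y j ?w * (if s < j then lvar j else 1)" if "j \<in> {1..s + m}" for j
    proof (cases "s < j")
      case True
      then have "bexp j = Suc k" using blk[of j] that by (simp add: bexp_def)
      then show ?thesis
        using prod_bino_Suc_anti_pair[where q = q and k = k and i = j and j = ?w] True
        by (simp add: kernel_def Y_def mult.commute del: prod.lessThan_Suc power_Suc)
    next
      case False
      then have "blk j \<noteq> p" "blk ?w = p" using blk[of j] blk[of ?w] that by auto
      then show ?thesis using False
        by (simp add: kernel_def Y_def bexp_def lam_def pairf_bino mult.commute del: power_Suc)
    qed
    have "inner = (\<Prod>(i, j)\<in>ordered_pairs {1..s + m}. Y i j * (if s < i \<and> s < j then lvar i - ?t * lvar j else 1))"
      unfolding inner_prod_def
      by (rule prod.cong) (auto simp: Y_def ordered_pairs_def lam_p pairf_Suc_anti_pair)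
    also have "\<dots> = (\<Prod>(i, j)\<in>ordered_pairs {1..s + m}. Y i j) *
        (\<Prod>(i, j)\<in>ordered_pairs {1..s + m}. if s < i \<and> s < j then lvar i - ?t * lvar j else 1)"
      by (simp add: prod.distrib case_prod_unfold)
    also have "(\<Prod>(i, j)\<in>ordered_pairs {1..s + m}. if s < i \<and> s < j then lvar i - ?t * lvar j else 1) =
        deformed_vandermonde m"
      unfolding prod_ordered_pairs_tail deformed_vandermonde_def ..
    finally have "inner = (\<Prod>(i, j)\<in>ordered_pairs {1..s + m}. Y i j) * deformed_vandermonde m" .
    moreover have "(\<Prod>j\<in>{1..s + m}. if s < j then lvar j else 1) = (\<Prod>i<m. ?v i)"
    proof -
      have "(\<Prod>j\<in>{1..s + m}. if s < j then lvar j else 1) = (\<Prod>j\<in>{s + 1..s + m}. lvar j :: 'a laurent)"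
        by (rule prod.mono_neutral_cong_right) auto
      also have "\<dots> = (\<Prod>i<m. ?v i)"
        by (rule prod.reindex_bij_witness[of _ "\<lambda>i. s + 1 + i" "\<lambda>j. j - s - 1"]) auto
      finally show ?thesis .
    qed
    ultimately show ?thesis
      unfolding Yprod_def prod_ordered_pairs_insert[of Y] using kern
      by (simp add: prod.distrib mult_ac)
  qed
  define B where "B f = constant_term (Yprod * f)" for f
  have swap: "lswap (s + 1 + i) (Suc (s + 1 + i)) Yprod = - Yprod" if "Suc i < Suc m" for i
    unfolding Yprod_def
  proof (rule lswap_prod_pairs)
    let ?x = "s + 1 + i"
    let ?\<sigma> = "transpose ?x (Suc ?x)"
    show "finite ?W" "?x \<in> ?W" "Suc ?x \<in> ?W" using that by auto
    have lt: "s < ?\<sigma> l \<longleftrightarrow> s < l" for l by (auto simp: transpose_def)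
    have "?\<sigma> l \<in> ?W \<and> blk (?\<sigma> l) = blk l" if "l \<in> ?W" for l
    proof (cases "l \<in> {?x, Suc ?x}")
      case True
      then have "?\<sigma> l \<in> ?W" "s < l" using \<open>Suc i < Suc m\<close> by (auto simp: transpose_def)
      then show ?thesis using blk[of l] blk[of "?\<sigma> l"] lt[of l] that by auto
    next
      case False
      then show ?thesis using that by (auto simp: transpose_def)
    qed
    then show "lswap ?x (Suc ?x) (Y a b) = Y (?\<sigma> a) (?\<sigma> b)" if "a \<in> ?W" "b \<in> ?W" for a b
      using that unfolding Y_def lt
      by (simp add: anti_pair_def sym_pair_def pairf_bino lam_def lswap_simps lswap_bino del: power_Suc)
    show "Y (Suc ?x) ?x = - Y ?x (Suc ?x)"
      by (simp add: Y_def) (rule anti_pair_swap)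
  qed
  have "alternating (Suc m) B"
    unfolding alternating_def
  proof (intro conjI allI impI)
    show "B (f + g) = B f + B g" for f g
      by (simp add: B_def distrib_left constant_term_add)
    show "B (?t * f) = q ^ Suc k * B f" for f
      unfolding B_def using constant_term_lconst[of "q ^ Suc k" "Yprod * f"] by (simp only: mult.left_commute)
    show "B (lswap (s + 1 + i) (Suc (s + 1 + i)) f) = - B f" if "Suc i < Suc m" for i f
    proof -
      have "lswap (s + 1 + i) (Suc (s + 1 + i)) (Yprod * f) = - (Yprod * lswap (s + 1 + i) (Suc (s + 1 + i)) f)"
        by (simp only: comm_ring_hom.mult[OF comm_ring_hom_lswap] swap[OF that] mult_minus_left)
      then have "constant_term (- (Yprod * lswap (s + 1 + i) (Suc (s + 1 + i)) f)) = constant_term (Yprod * f)"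
        by (metis constant_term_lswap)
      then show ?thesis by (simp add: B_def constant_term_def minus_equation_iff eq_commute)
    qed
  qed
  from alternating_deformed_vandermonde_Suc[OF this] show ?thesis
    using constant_term_kernel[of ?w k] unfolding B_def full[symmetric] part[symmetric] by simp
qed

theorem mainTheorem8:
  fixes p k N :: nat and n :: "nat \<Rightarrow> nat" and q :: "rat poly fract"
  assumes "q = q_indet"
    and "p \<ge> 1"
    and "\<forall>\<alpha>\<in>{1..p}. n \<alpha> \<ge> 1"
    and "k \<ge> 1"
    and "\<forall>j\<in>{1..<p}. n p > n j"
    and "N = (\<Sum>j\<le>p. n j)"
  shows "D p (n(p := n p + 1)) k q / D p n k q =
           qnumber (q ^ (k + 1)) (n p + 1) / qfactorial q k *
           (qGamma q ((k + 1) * (n p + 1) + k * (\<Sum>j<p. n j)) /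
            qGamma q (1 + (k + 1) * n p + k * (\<Sum>j<p. n j)))
       \<and> qnumber (q ^ (k + 1)) (n p + 1) / qfactorial q k *
           (qGamma q ((k + 1) * (n p + 1) + k * (\<Sum>j<p. n j)) /
            qGamma q (1 + (k + 1) * n p + k * (\<Sum>j<p. n j))) =
         qnumber (q ^ (k + 1)) (n p + 1) / qfactorial q k *
           (qfactorial q (k * (N + 1) + n p) / qfactorial q (k * N + n p))"
proof -
  interpret generic_q q unfolding assms(1) by (rule generic_q_indet)
  define s where "s = (\<Sum>j<p. n j)"
  define n' where "n' = n(p := n p + 1)"
  \<comment> \<open>Labels of the enlarged tuple: the last block grows at its end, so they fit the
    original tuple on \<open>{1..N}\<close> as well.\<close>
  define blk where "blk = block_of n'"
  have N: "N = s + n p" unfolding assms(6) s_def by (simp flip: lessThan_Suc_atMost)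
  have N': "(\<Sum>j\<le>p. n' j) = Suc N"
  proof -
    have "(\<Sum>j<p. n' j) = s" unfolding s_def n'_def by (rule sum.cong) auto
    then show ?thesis by (simp add: N n'_def flip: lessThan_Suc_atMost)
  qed
  have J: "Jblock n' \<alpha> = Jblock n \<alpha>" if "\<alpha> < p" for \<alpha>
    using that by (simp add: Jblock_def n'_def)
  have Jp: "Jblock n' p = {s + 1..Suc N}" "Jblock n p = {s + 1..N}"
    using N' by (simp_all add: Jblock_def s_def assms(6)) (simp add: n'_def)
  have blk': "i \<in> Jblock n' \<alpha> \<longleftrightarrow> blk i = \<alpha>" if "i \<in> {1..Suc N}" for i \<alpha>
    unfolding blk_def using that by (intro Jblock_iff_block_of[of i n' p]) (auto simp: N')
  have le: "blk i \<le> p" if "i \<in> {1..Suc N}" for i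
    unfolding blk_def using that by (intro block_of_le) (simp add: N')
  have blk: "i \<in> Jblock n \<alpha> \<longleftrightarrow> blk i = \<alpha>" if "i \<in> {1..N}" "\<alpha> \<le> p" for i \<alpha>
    using blk'[of i \<alpha>] J[of \<alpha>] Jp that by (cases "\<alpha> = p") auto
  have D: "D p n k q = constant_term (inner_prod q k blk {1..N})"
    unfolding D_def assms(6) using blk le
    by (subst D_integrand_eq_inner_prod[where blk = blk]) (auto simp: assms(6))
  have D': "D p n' k q = constant_term (inner_prod q k blk {1..Suc N})"
    unfolding D_def N'[symmetric] using blk' le
    by (subst D_integrand_eq_inner_prod[where blk = blk]) (auto simp: N')
  have card: "card {j\<in>{1..N}. blk j = \<alpha>} = n \<alpha>" if "\<alpha> \<le> p" for \<alpha>
  proof -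
    have "(\<Sum>j\<le>\<alpha>. n j) \<le> N" unfolding assms(6) using that by (intro sum_mono2) auto
    then have "Jblock n \<alpha> \<subseteq> {1..N}" by (auto simp: Jblock_def)
    then have "{j\<in>{1..N}. blk j = \<alpha>} = Jblock n \<alpha>" using blk that by blast
    then show ?thesis by (simp add: Jblock_def flip: lessThan_Suc_atMost)
  qed
  interpret dyson_blocks q "{1..N}" k p blk
  proof
    show "blk i \<le> blk j" if "i \<in> {1..N}" "j \<in> {1..N}" "i \<le> j" for i j
      unfolding blk_def using that by (intro block_of_mono[where p = p]) (auto simp: N')
    show "card {j\<in>{1..N}. blk j = \<alpha>} \<le> card {j\<in>{1..N}. blk j = p}" if "\<alpha> \<in> {1..p}" for \<alpha>
      using that assms(5) card[of \<alpha>] card[of p] by (cases "\<alpha> = p") (auto intro: less_imp_le)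
    show "blk j \<le> p" if "j \<in> {1..N}" for j using le that by auto
  qed (use assms in auto)
  have total: "total = k * N + n p" unfolding total_eq card[OF order_refl] by simp
  have "blk i = p \<longleftrightarrow> s < i" if "i \<in> {1..Suc (s + n p)}" for i
    using blk'[of i p] that N Jp by auto
  from constant_term_inner_prod_Suc[OF dyson_blocks_axioms[unfolded N] this]
  have rec: "D p n' k q = (\<Sum>r<Suc (n p). (q ^ Suc k) ^ r) * poly ct_poly (q ^ k)"
    unfolding D' by (simp only: N)
  have geo: "(\<Sum>r<Suc (n p). (q ^ Suc k) ^ r) = qnumber (q ^ (k + 1)) (n p + 1)"
  proof -
    have "(\<Sum>r<Suc (n p). (q ^ Suc k) ^ r) = ((q ^ Suc k) ^ Suc (n p) - 1) / (q ^ Suc k - 1)"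
      using q_root[of "Suc k"] by (intro geometric_sum) auto
    also have "\<dots> = (1 - (q ^ Suc k) ^ Suc (n p)) / (1 - q ^ Suc k)"
      using minus_divide_divide[of "1 - (q ^ Suc k) ^ Suc (n p)" "1 - q ^ Suc k"]
      by (simp only: minus_diff_eq)
    finally show ?thesis by (simp only: qnumber_def Suc_eq_plus1)
  qed
  have nz: "D p n k q \<noteq> 0" unfolding D unfolding assms(1) by (rule constant_term_inner_prod_q_indet) simp
  have "(\<Prod>h=1..total. 1 - q ^ h) \<noteq> 0" using q_root by (auto simp: eq_commute[of 1])
  then have "poly ct_poly (q ^ k) / D p n k q = (\<Prod>h=1..total. 1 - q ^ (k + h)) / (\<Prod>h=1..total. 1 - q ^ h)"
    using ct_poly_eq[of k] nz unfolding D by (simp add: frac_eq_eq mult.commute)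
  also have "\<dots> = qfactorial q (k + total) / (qfactorial q k * qfactorial q total)"
    by (rule prod_ratio_qfactorial)
  also note total
  also have "k + (k * N + n p) = k * (N + 1) + n p" by simp
  finally have ratio: "D p n' k q / D p n k q =
      qnumber (q ^ (k + 1)) (n p + 1) / qfactorial q k * (qfactorial q (k * (N + 1) + n p) / qfactorial q (k * N + n p))"
    unfolding rec geo times_divide_eq_right[symmetric] by (simp add: mult_ac)
  \<comment> \<open>Both arguments are successors, so \<open>qGamma\<close> is never taken at its
    dummy value and drops to the factorial one below.\<close>
  have args: "(k + 1) * (n p + 1) + k * (\<Sum>j<p. n j) = Suc (k * (N + 1) + n p)"
    "1 + (k + 1) * n p + k * (\<Sum>j<p. n j) = Suc (k * N + n p)"
    by (simp_all add: N s_def algebra_simps)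
  show ?thesis unfolding n'_def[symmetric] ratio args qGamma.simps by simp
qed

end
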